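(* Let $\gamma=(\gamma_1+i\gamma_2,\gamma_3):S^1\to\mathbb{L}^3$ be a real analytic null closed curve and $L=(L_1+iL_2,L_3):S^1\to\mathbb{L}^3$ a real analytic null vector field such that $\langle\gamma',L\rangle=0$, and such that at least one of $\gamma'$ and $L$ does not vanish identically. Let $g$ be the function on $S^1$ associated with $(\gamma,L)$ as defined in the context, and let $g(z)$ denote its analytic extension. If $|g(z)|$ is not identically equal to $1$, then there exists a unique generalised maximal surface $F=(h,w)$ defined on some annulus $A(r,R)=\{z\in\mathbb{C}:0<r<|z|<R\}$ with $r<1<R$, such that (1) $F(e^{i\theta})=(h(e^{i\theta}),w(e^{i\theta}))=\gamma(e^{i\theta})$ for all $\theta$; (2) $\left.\dfrac{\partial F}{\partial\rho}\right|_{e^{i\theta}}=(h_\rho(e^{i\theta}),w_\rho(e^{i\theta}))=L(e^{i\theta})$ for all $\theta$, where $z=\rho e^{i\theta}$; and whose singular set contains at least $\{|z|=1\}$.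
   Context: $\mathbb{L}^3$ is $\mathbb{R}^3$ with the metric $\langle\cdot,\cdot\rangle=dx^2+dy^2-dt^2$, identified with $\mathbb{C}\times\mathbb{R}$ via $(x,y,t)\mapsto(x+iy,t)$. For a map defined on $S^1=\{e^{i\theta}\}$, the prime denotes $d/d\theta$. A curve $\gamma$ is null if $\langle\gamma',\gamma'\rangle=0$ everywhere, and a vector field $L$ along $S^1$ is null if $\langle L,L\rangle=0$ everywhere; zero vectors are allowed (in particular $\gamma$ may be constant). A generalised maximal surface on a domain $\Omega\subset\mathbb{C}$ is given by a smooth map $F=(h,w):\Omega\to\mathbb{C}\times\mathbb{R}$ such that $h_{z\bar z}=0$ and $w_{z\bar z}=0$ on $\Omega$, $h_z\overline{h_{\bar z}}-w_z^2=0$ on $\Omega$, and $|h_z|$ is not identically equal to $|h_{\bar z}|$ on $\Omega$. (Strictly, a generalised maximal surface is the equivalence class of such maps under change of conformal parameter.) Its singular set is $\{z\in\Omega:|h_z|=|h_{\bar z}|\}$. The function $g$ on $S^1$: if $\gamma'$ vanishes identically, $g=\sqrt{\dfrac{L_1+iL_2}{L_1-iL_2}}$; if $L$ vanishes identically, $g=\sqrt{\dfrac{\gamma_1'+i\gamma_2'}{\gamma_1'-i\gamma_2'}}$; if neither vanishes identically, these two expressions agree (because $\gamma'$ and $L$ are null and orthogonal, hence linearly dependent at each point), and $g$ is their common value. Here the square root is an analytic branch on $S^1$, and the quotient is extended analytically across isolated zeros of the denominator; $g(z)$ is the analytic extension of $g(e^{i\theta})$ to a neighbourhood of $S^1$ in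 $\mathbb{C}$. *)

theory Defs
  imports "HOL-Complex_Analysis.Complex_Analysis"
begin

section \<open>Lorentz-Minkowski space\<close>

text \<open>\<open>complex \<times> real\<close> carries the metric \<open>dx\<^sup>2 + dy\<^sup>2 - dt\<^sup>2\<close>, with \<open>(x, y, t)\<close> identified with \<open>(x + i y, t)\<close>.\<close>

definition lorentz :: "complex \<times> real \<Rightarrow> complex \<times> real \<Rightarrow> real" where
  "lorentz u v = Re (fst u) * Re (fst v) + Im (fst u) * Im (fst v) - snd u * snd v"

section \<open>Maps on the unit circle\<close>

text \<open>A map on the unit circle is a total function on \<open>complex\<close> of which only the values
  \<open>f (cis \<theta>)\<close> matter.\<close>

definition real_analytic :: "(real \<Rightarrow> 'a::real_normed_vector) \<Rightarrow> bool" where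
  "real_analytic f \<longleftrightarrow>
     (\<forall>t0. \<exists>a. \<exists>\<epsilon>>0. \<forall>t. \<bar>t - t0\<bar> < \<epsilon> \<longrightarrow> (\<lambda>n. (t - t0) ^ n *\<^sub>R a n) sums f t)"

definition circle_analytic :: "(complex \<Rightarrow> 'a::real_normed_vector) \<Rightarrow> bool" where
  "circle_analytic f \<longleftrightarrow> real_analytic (\<lambda>\<theta>. f (cis \<theta>))"

definition circle_deriv :: "(complex \<Rightarrow> 'a::real_normed_vector) \<Rightarrow> real \<Rightarrow> 'a" where
  "circle_deriv f \<theta> = vector_derivative (\<lambda>t. f (cis t)) (at \<theta>)"

text \<open>For \<open>v = (v\<^sub>1 + i v\<^sub>2, v\<^sub>3)\<close> this is \<open>(v\<^sub>1 + i v\<^sub>2) / (v\<^sub>1 - i v\<^sub>2)\<close>.\<close>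

definition dir_quotient :: "complex \<times> real \<Rightarrow> complex" where
  "dir_quotient v = fst v / cnj (fst v)"

text \<open>\<open>g\<close> is an analytic branch on the circle of the square root of the quotient of \<open>\<gamma>'\<close> and of
  the quotient of \<open>L\<close>. Each condition is imposed where its denominator is nonzero; the
  values of \<open>g\<close> at the isolated zeros are then fixed by continuity. If \<open>\<gamma>'\<close> (respectively
  \<open>L\<close>) vanishes identically, the corresponding condition is void. The branch is determined up to
  a global sign.\<close>

definition associated_g ::
    "(complex \<Rightarrow> complex \<times> real) \<Rightarrow> (complex \<Rightarrow> complex \<times> real) \<Rightarrow> (complex \<Rightarrow> complex) \<Rightarrow> bool" where
  "associated_g \<gamma> L g \<longleftrightarrow>
     circle_analytic g \<and>
     (\<forall>\<theta>. cnj (fst (circle_deriv \<gamma> \<theta>)) \<noteq> 0 \<longrightarrow> (g (cis \<theta>))\<^sup>2 = dir_quotient (circle_deriv \<gamma> \<theta>)) \<and>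
     (\<forall>\<theta>. cnj (fst (L (cis \<theta>))) \<noteq> 0 \<longrightarrow> (g (cis \<theta>))\<^sup>2 = dir_quotient (L (cis \<theta>)))"

text \<open>The neighbourhood is taken connected, so that the extension is determined by \<open>g\<close>.\<close>

definition analytic_extension :: "(complex \<Rightarrow> complex) \<Rightarrow> complex set \<Rightarrow> (complex \<Rightarrow> complex) \<Rightarrow> bool" where
  "analytic_extension g U G \<longleftrightarrow>
     open U \<and> connected U \<and> sphere 0 1 \<subseteq> U \<and> G holomorphic_on U \<and> (\<forall>\<theta>. G (cis \<theta>) = g (cis \<theta>))"

section \<open>Generalised maximal surfaces\<close>

text \<open>For open \<open>S\<close>, being \<open>C\<^sup>k\<close> on \<open>S\<close>.\<close>

primrec Ck_on :: "nat \<Rightarrow> ('a::real_normed_vector \<Rightarrow> 'b::real_normed_vector) \<Rightarrow> 'a set \<Rightarrow> bool" where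
  "Ck_on 0 f S \<longleftrightarrow> continuous_on S f"
| "Ck_on (Suc k) f S \<longleftrightarrow>
     (\<forall>x\<in>S. f differentiable (at x)) \<and> (\<forall>v. Ck_on k (\<lambda>x. frechet_derivative f (at x) v) S)"

definition smooth_on :: "('a::real_normed_vector \<Rightarrow> 'b::real_normed_vector) \<Rightarrow> 'a set \<Rightarrow> bool" where
  "smooth_on f S \<longleftrightarrow> (\<forall>k. Ck_on k f S)"

text \<open>Wirtinger derivatives \<open>(f\<^sub>x - i f\<^sub>y) / 2\<close> and \<open>(f\<^sub>x + i f\<^sub>y) / 2\<close>.\<close>

definition dz :: "(complex \<Rightarrow> complex) \<Rightarrow> complex \<Rightarrow> complex" where
  "dz f z = (frechet_derivative f (at z) 1 - \<i> * frechet_derivative f (at z) \<i>) / 2"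

definition dzbar :: "(complex \<Rightarrow> complex) \<Rightarrow> complex \<Rightarrow> complex" where
  "dzbar f z = (frechet_derivative f (at z) 1 + \<i> * frechet_derivative f (at z) \<i>) / 2"

abbreviation hpart :: "(complex \<Rightarrow> complex \<times> real) \<Rightarrow> complex \<Rightarrow> complex" where
  "hpart F \<equiv> (\<lambda>z. fst (F z))"

abbreviation wpart :: "(complex \<Rightarrow> complex \<times> real) \<Rightarrow> complex \<Rightarrow> complex" where
  "wpart F \<equiv> (\<lambda>z. complex_of_real (snd (F z)))"

definition generalised_maximal_surface :: "complex set \<Rightarrow> (complex \<Rightarrow> complex \<times> real) \<Rightarrow> bool" where
  "generalised_maximal_surface \<Omega> F \<longleftrightarrow>
     open \<Omega> \<and> connected \<Omega> \<and> smooth_on F \<Omega> \<and>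
     (\<forall>z\<in>\<Omega>. dzbar (dz (hpart F)) z = 0) \<and>
     (\<forall>z\<in>\<Omega>. dzbar (dz (wpart F)) z = 0) \<and>
     (\<forall>z\<in>\<Omega>. dz (hpart F) z * cnj (dzbar (hpart F) z) - (dz (wpart F) z)\<^sup>2 = 0) \<and>
     \<not> (\<forall>z\<in>\<Omega>. cmod (dz (hpart F) z) = cmod (dzbar (hpart F) z))"

definition singular_set :: "complex set \<Rightarrow> (complex \<Rightarrow> complex \<times> real) \<Rightarrow> complex set" where
  "singular_set \<Omega> F = {z \<in> \<Omega>. cmod (dz (hpart F) z) = cmod (dzbar (hpart F) z)}"

definition annulus :: "real \<Rightarrow> real \<Rightarrow> complex set" where
  "annulus r R = {z. r < cmod z \<and> cmod z < R}"

definition bjorling_solution ::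
    "(complex \<Rightarrow> complex \<times> real) \<Rightarrow> (complex \<Rightarrow> complex \<times> real) \<Rightarrow> real \<Rightarrow> real
      \<Rightarrow> (complex \<Rightarrow> complex \<times> real) \<Rightarrow> bool" where
  "bjorling_solution \<gamma> L r R F \<longleftrightarrow>
     0 < r \<and> r < 1 \<and> 1 < R \<and>
     generalised_maximal_surface (annulus r R) F \<and>
     (\<forall>\<theta>. F (cis \<theta>) = \<gamma> (cis \<theta>)) \<and>
     (\<forall>\<theta>. ((\<lambda>\<rho>. F (complex_of_real \<rho> * cis \<theta>)) has_vector_derivative L (cis \<theta>)) (at 1)) \<and>
     sphere 0 1 \<subseteq> singular_set (annulus r R) F"

end

theory Submission
  imports Defs
begin

text \<open>Analytic data on the circle extend holomorphically to an annulus. There the harmonic Cauchy problem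
  for \<open>h\<close> and \<open>w\<close> is solved explicitly, and \<open>h\<^sub>z\<close>, the conjugate of the \<open>zbar\<close>-derivative of \<open>h\<close>,
  and \<open>w\<^sub>z\<close> are holomorphic functions \<open>p\<close>, \<open>q\<close>, \<open>m\<close> whose values on the circle are, up to the
  factor \<open>1 / (2 z)\<close>, \<open>L - i \<gamma>'\<close> in the components. Since \<open>\<gamma>'\<close> and \<open>L\<close> are null and orthogonal,
  \<open>p q = m\<^sup>2\<close> and \<open>|p| = |q|\<close> on the circle; the first identity propagates by analytic continuation.
  Likewise \<open>p = g\<^sup>2 q\<close> near the circle, so \<open>|p| = |q|\<close> everywhere would force \<open>|g| = 1\<close> everywhere.\<close>

section \<open>Holomorphic extension from the unit circle\<close>

lemma unit_circle_cis: "cmod z = 1 \<Longrightarrow> \<exists>t. z = cis t"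
  by (metis cis_rcis_eq rcis_cmod_Arg)

text \<open>The circle is connected and has more than one point, so \<open>z0\<close> is a limit
  point of circle points in \<open>S\<close>; the identity theorem then applies to
  \<open>f - g\<close>.\<close>

lemma holomorphic_eq_if_eq_on_circle:
  assumes "open S" "connected S" "z0 \<in> S" "cmod z0 = 1"
    and "f holomorphic_on S" "g holomorphic_on S"
    and eq: "\<And>z. z \<in> S \<Longrightarrow> cmod z = 1 \<Longrightarrow> f z = g z"
    and "z \<in> S"
  shows "f z = g z"
proof -
  have "sphere (0::complex) 1 \<noteq> {x}" for x
  proof
    assume "sphere 0 1 = {x}"
    moreover have "1 \<in> sphere (0::complex) 1" "-1 \<in> sphere (0::complex) 1" by auto
    ultimately have "(1::complex) = -1" by auto
    then show False by simp
  qed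
  then have "z0 islimpt sphere 0 1"
    using assms(4) by (intro connected_imp_perfect connected_sphere) auto
  then have lim: "z0 islimpt sphere 0 1 \<inter> S"
    using eventually_at_in_open'[OF assms(1,3)] by (rule islimpt_Int_eventually)
  have hol: "(\<lambda>z. f z - g z) holomorphic_on S"
    by (intro holomorphic_on_diff assms)
  have "f z - g z = 0"
    by (rule analytic_continuation[OF hol assms(1,2) _ assms(3) lim _ assms(8)])
      (use eq in auto)
  then show ?thesis by simp
qed

lemma real_analytic_bounded_linear:
  assumes "bounded_linear T" "real_analytic f"
  shows "real_analytic (\<lambda>t. T (f t))"
  unfolding real_analytic_def
proof
  fix t0
  obtain a \<epsilon> where "\<epsilon> > 0" and s: "\<And>t. \<bar>t - t0\<bar> < \<epsilon> \<Longrightarrow> (\<lambda>n. (t - t0) ^ n *\<^sub>R a n) sums f t"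
    using assms(2) unfolding real_analytic_def by metis
  have "(\<lambda>n. (t - t0) ^ n *\<^sub>R T (a n)) sums T (f t)" if "\<bar>t - t0\<bar> < \<epsilon>" for t
  proof -
    have "(\<lambda>n. T ((t - t0) ^ n *\<^sub>R a n)) sums T (f t)"
      by (rule bounded_linear.sums[OF assms(1) s[OF that]])
    moreover have "T (x *\<^sub>R y) = x *\<^sub>R T y" for x y
      by (rule linear_scale[OF bounded_linear.linear[OF assms(1)]])
    ultimately show ?thesis by simp
  qed
  then show "\<exists>a. \<exists>\<epsilon>>0. \<forall>t. \<bar>t - t0\<bar> < \<epsilon> \<longrightarrow> (\<lambda>n. (t - t0) ^ n *\<^sub>R a n) sums T (f t)"
    using \<open>\<epsilon> > 0\<close> by (intro exI[of _ "\<lambda>n. T (a n)"] exI[of _ \<epsilon>]) auto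
qed

text \<open>The real power series at \<open>t0\<close> is read with a complex variable; convergence
  at the real points gives convergence on the complex disc of the same radius.\<close>

lemma real_analytic_local_extension:
  fixes f :: "real \<Rightarrow> complex"
  assumes "real_analytic f"
  obtains \<epsilon> \<phi> where "\<epsilon> > 0" "\<phi> holomorphic_on ball (of_real t0) \<epsilon>"
    "\<And>t. \<bar>t - t0\<bar> < \<epsilon> \<Longrightarrow> \<phi> (of_real t) = f t"
proof -
  obtain a \<epsilon> where \<epsilon>: "\<epsilon> > 0" and s: "\<And>t. \<bar>t - t0\<bar> < \<epsilon> \<Longrightarrow> (\<lambda>n. (t - t0) ^ n *\<^sub>R a n) sums f t"
    using assms unfolding real_analytic_def by metis
  define \<phi> where "\<phi> w = (\<Sum>n. a n * (w - of_real t0) ^ n)" for w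
  have "(\<lambda>n. a n * (w - of_real t0) ^ n) sums \<phi> w" if "w \<in> ball (of_real t0) \<epsilon>" for w
  proof -
    have "cmod (w - of_real t0) < \<epsilon>" using that by (simp add: dist_norm norm_minus_commute)
    \<comment> \<open>A real point \<open>t0 + x\<close> of convergence, strictly farther from the
      centre than \<open>w\<close>.\<close>
    then obtain x where x: "cmod (w - of_real t0) < x" "x < \<epsilon>" using dense by blast
    then have x0: "x > 0" using norm_ge_zero[of "w - of_real t0"] by linarith
    have "summable (\<lambda>n. a n * of_real x ^ n)"
      using s[of "t0 + x"] x x0 by (auto simp: sums_iff scaleR_conv_of_real mult.commute)
    from powser_inside[OF this] x x0 show ?thesis
      unfolding \<phi>_def by (intro summable_sums) auto
  qed
  then have "\<phi> holomorphic_on ball (of_real t0) \<epsilon>" by (rule power_series_holomorphic)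
  moreover have "\<phi> (of_real t) = f t" if "\<bar>t - t0\<bar> < \<epsilon>" for t
    using s[OF that] by (auto simp: \<phi>_def sums_iff scaleR_conv_of_real mult.commute)
  ultimately show ?thesis using that \<epsilon> by blast
qed

text \<open>The complexified parametrisation \<open>w \<mapsto> exp (i w)\<close> is inverted near
  \<open>u\<close> by \<open>lg\<close>, which is real on the circle, and the local extension in the
  parameter is pulled back along it.\<close>

lemma circle_analytic_local_extension:
  fixes f :: "complex \<Rightarrow> complex"
  assumes "circle_analytic f" "cmod u = 1"
  obtains r \<phi> where "r > 0" "\<phi> holomorphic_on ball u r"
    "\<And>z. z \<in> ball u r \<Longrightarrow> cmod z = 1 \<Longrightarrow> \<phi> z = f z"
proof -
  obtain t where t: "u = cis t" using unit_circle_cis[OF assms(2)] by blast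
  obtain \<epsilon> \<psi> where \<epsilon>: "\<epsilon> > 0" and hol: "\<psi> holomorphic_on ball (of_real t) \<epsilon>"
    and \<psi>: "\<And>s. \<bar>s - t\<bar> < \<epsilon> \<Longrightarrow> \<psi> (of_real s) = f (cis s)"
    using real_analytic_local_extension[of "\<lambda>t. f (cis t)" t] assms(1)
    unfolding circle_analytic_def by metis
  \<comment> \<open>On this half-plane \<open>z / u\<close> stays off the branch cut of
    \<open>Ln\<close>.\<close>
  define H where "H = {z. Re (z / u) > 0}"
  define lg where "lg z = of_real t - \<i> * Ln (z / u)" for z
  have [simp]: "u \<noteq> 0" using assms(2) by auto
  have oH: "open H" unfolding H_def by (intro open_Collect_less continuous_intros) auto
  have pos: "z / u \<notin> \<real>\<^sub>\<le>\<^sub>0" if "z \<in> H" for z using that by (auto simp: H_def complex_nonpos_Reals_iff)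
  have hollg: "lg holomorphic_on H"
    unfolding lg_def using pos by (intro holomorphic_intros) auto
  then have "continuous_on H lg" by (rule holomorphic_on_imp_continuous_on)
  then have op: "open (H \<inter> lg -` ball (of_real t) \<epsilon>)"
    using oH by (rule continuous_open_preimage) simp
  have "u \<in> H \<inter> lg -` ball (of_real t) \<epsilon>" using \<epsilon> by (simp add: H_def lg_def)
  with op obtain r where r: "r > 0" "ball u r \<subseteq> H \<inter> lg -` ball (of_real t) \<epsilon>"
    using open_contains_ball_eq by metis
  show ?thesis
  proof (rule that[of r "\<psi> \<circ> lg"])
    show "r > 0" by fact
    show "\<psi> \<circ> lg holomorphic_on ball u r"
      using r by (intro holomorphic_on_compose_gen[OF holomorphic_on_subset[OF hollg] hol]) auto
    fix z assume z: "z \<in> ball u r" "cmod z = 1"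
    then have zH: "z \<in> H" "lg z \<in> ball (of_real t) \<epsilon>" using r by auto
    have nz: "z / u \<noteq> 0" using z by auto
    have "Re (Ln (z / u)) = 0" using nz z assms(2) by (simp add: norm_divide)
    then have im: "lg z = of_real (Re (lg z))" by (simp add: complex_eq_iff lg_def)
    have "cis (Re (lg z)) = exp (\<i> * lg z)" using im by (simp add: cis_conv_exp)
    also have "\<dots> = exp (\<i> * of_real t) * exp (Ln (z / u))"
      by (simp add: lg_def algebra_simps flip: exp_add)
    also have "\<dots> = z" using nz by (simp add: t cis_conv_exp)
    finally have c: "cis (Re (lg z)) = z" .
    have "\<bar>Re (lg z) - t\<bar> < \<epsilon>"
      using zH(2) im by (metis dist_commute dist_norm mem_ball norm_of_real of_real_diff)
    from \<psi>[OF this] im c show "(\<psi> \<circ> lg) z = f z" by simp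
  qed
qed

section \<open>Gluing the local extensions along the circle\<close>

lemma open_annulus [simp]: "open (annulus r R)"
  unfolding annulus_def by (intro open_Collect_conj open_Collect_less continuous_intros)

lemma connected_annulus_complex [simp]: "connected (annulus r R)"
  using connected_annulus(1)[where 'N = complex, of r 0 R] by (simp add: annulus_def)

lemma annulus_mono: "r' \<le> r \<Longrightarrow> R \<le> R' \<Longrightarrow> annulus r R \<subseteq> annulus r' R'"
  by (auto simp: annulus_def)

lemma dist_sgn:
  fixes z :: "'a::real_normed_vector"
  assumes "z \<noteq> 0"
  shows "dist z (sgn z) = \<bar>norm z - 1\<bar>"
proof -
  have "z - sgn z = (norm z - 1) *\<^sub>R sgn z"
    using assms by (simp add: sgn_div_norm algebra_simps)
  then show ?thesis using assms by (simp add: dist_norm norm_sgn)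
qed

text \<open>Local extensions on balls of half radius agree on overlaps, because the two full balls
  share a point of the circle and meet in a convex set. Compactness of the circle then yields an
  annulus covered by these balls.\<close>

theorem circle_analytic_extension:
  fixes f :: "complex \<Rightarrow> complex"
  assumes "circle_analytic f"
  obtains R c where "R > 1" "c holomorphic_on annulus (1 / R) R"
    "\<And>z. cmod z = 1 \<Longrightarrow> c z = f z"
proof -
  let ?C = "sphere (0::complex) 1"
  have "\<forall>u\<in>?C. \<exists>r \<phi>. r > 0 \<and> \<phi> holomorphic_on ball u r \<and>
      (\<forall>z. z \<in> ball u r \<longrightarrow> cmod z = 1 \<longrightarrow> \<phi> z = f z)"
    using circle_analytic_local_extension[OF assms] by (metis dist_0_norm mem_sphere)
  then obtain r \<phi> where r: "\<And>u. u \<in> ?C \<Longrightarrow> r u > 0"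
    and hol: "\<And>u. u \<in> ?C \<Longrightarrow> \<phi> u holomorphic_on ball u (r u)"
    and \<phi>: "\<And>u z. u \<in> ?C \<Longrightarrow> z \<in> ball u (r u) \<Longrightarrow> cmod z = 1 \<Longrightarrow> \<phi> u z = f z"
    by metis
  \<comment> \<open>Halving the radius pays for the radial projection: \<open>sgn z\<close> is at
    most twice as far from \<open>u\<close> as \<open>z\<close> is. The origin is excluded because
    \<open>sgn 0\<close> is not on the circle.\<close>
  have near: "sgn z \<in> ball u (r u)" if "z \<in> ball u (r u / 2)" "u \<in> ?C" "z \<noteq> 0" for z u
  proof -
    have "dist z (sgn z) = \<bar>cmod z - cmod u\<bar>"
      using that by (simp add: dist_sgn)
    also have "\<dots> \<le> dist u z" by (simp add: dist_norm norm_minus_commute[of u z] norm_triangle_ineq3)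
    finally have "dist u (sgn z) \<le> 2 * dist u z" using dist_triangle[of u "sgn z" z] by simp
    then show ?thesis using that by simp
  qed
  have glue: "\<phi> u z = \<phi> v z"
    if "u \<in> ?C" "v \<in> ?C" "z \<noteq> 0" "z \<in> ball u (r u / 2)" "z \<in> ball v (r v / 2)" for u v z
  proof (rule holomorphic_eq_if_eq_on_circle[of "ball u (r u) \<inter> ball v (r v)" "sgn z" "\<phi> u" "\<phi> v" z])
    show "connected (ball u (r u) \<inter> ball v (r v))"
      by (intro convex_connected convex_Int convex_ball)
    show "sgn z \<in> ball u (r u) \<inter> ball v (r v)" using near that by blast
    show "\<phi> u holomorphic_on ball u (r u) \<inter> ball v (r v)"
      "\<phi> v holomorphic_on ball u (r u) \<inter> ball v (r v)"
      using hol that by (meson holomorphic_on_subset inf_le1 inf_le2)+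
    show "z \<in> ball u (r u) \<inter> ball v (r v)"
      using that r[of u] r[of v] by (auto simp del: mem_sphere)
  qed (use that \<phi> in \<open>auto simp: norm_sgn\<close>)
  define W where "W = (\<Union>u\<in>?C. ball u (r u / 2))"
  define c where "c z = \<phi> (SOME u. u \<in> ?C \<and> z \<in> ball u (r u / 2)) z" for z
  have c: "c z = \<phi> u z" if "u \<in> ?C" "z \<noteq> 0" "z \<in> ball u (r u / 2)" for u z
  proof -
    let ?P = "\<lambda>u. u \<in> ?C \<and> z \<in> ball u (r u / 2)"
    have "?P (SOME u. ?P u)" by (rule someI[of ?P u]) (use that in auto)
    then show ?thesis unfolding c_def using glue that by blast
  qed
  have "?C \<subseteq> W" using r unfolding W_def by (force intro!: centre_in_ball[THEN iffD2])
  then obtain e where e: "e > 0" "(\<Union>x\<in>?C. ball x e) \<subseteq> W"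
    by (rule compact_subset_open_imp_ball_epsilon_subset[of ?C W, rotated 2]) (auto simp: W_def)
  \<comment> \<open>With \<open>R = 1 + e\<close> the inner radius \<open>1 / R\<close> exceeds
    \<open>1 - e\<close>, so every point of the annulus is within \<open>e\<close> of its radial
    projection.\<close>
  define R where "R = 1 + e"
  have R: "R > 1" "1 / R > 1 - e"
    using e by (auto simp: R_def field_simps)
  have AW: "z \<in> W" if "z \<in> annulus (1 / R) R" for z
  proof -
    have z: "cmod z < 1 + e" "cmod z > 1 - e" "z \<noteq> 0"
      using that R by (auto simp: annulus_def R_def)
    have "dist (sgn z) z < e"
      using z dist_sgn[of z] by (simp add: dist_commute[of "sgn z"] abs_if)
    then show ?thesis using e(2) z(3) by (force simp: norm_sgn)
  qed
  show ?thesis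
  proof (rule that[OF R(1), of c])
    show "c holomorphic_on annulus (1 / R) R"
      unfolding holomorphic_on_def
    proof
      fix z assume z: "z \<in> annulus (1 / R) R"
      then have z0: "z \<noteq> 0" using R(1) by (auto simp: annulus_def)
      obtain u where u: "u \<in> ?C" "z \<in> ball u (r u / 2)" using AW[OF z] by (auto simp: W_def)
      have sub: "ball u (r u / 2) - {0} \<subseteq> ball u (r u)" using r[OF u(1)] by auto
      have "c holomorphic_on (ball u (r u / 2) - {0})"
        using holomorphic_on_subset[OF hol[OF u(1)] sub] c[OF u(1)]
        by (metis (no_types, lifting) Diff_iff holomorphic_cong insertCI)
      then have "c field_differentiable at z"
        using u z0 by (intro holomorphic_on_imp_differentiable_at[of _ "ball u (r u / 2) - {0}"]) auto
      then show "c field_differentiable at z within annulus (1 / R) R"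
        by (rule field_differentiable_at_within)
    qed
    fix z :: complex assume z: "cmod z = 1"
    then obtain u where u: "u \<in> ?C" "z \<in> ball u (r u / 2)"
      using \<open>?C \<subseteq> W\<close> by (auto simp: W_def)
    then show "c z = f z" using c[of u z] \<phi>[of u z] z r[of u] by force
  qed
qed

section \<open>Harmonic functions with prescribed Cauchy data\<close>

text \<open>The radii are reciprocal so that inversion in the unit circle maps the annulus to
  itself.\<close>

abbreviation sym_annulus :: "real \<Rightarrow> complex set" where
  "sym_annulus R \<equiv> annulus (1 / R) R"

lemma circle_in_sym_annulus: "R > 1 \<Longrightarrow> cmod z = 1 \<Longrightarrow> z \<in> sym_annulus R"
  by (simp add: annulus_def)

lemma sym_annulus_nonzero: "R > 1 \<Longrightarrow> z \<in> sym_annulus R \<Longrightarrow> z \<noteq> 0"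
  by (auto simp: annulus_def)

section \<open>Reflection in the unit circle\<close>

lemma inverse_cnj_unit: "cmod z = 1 \<Longrightarrow> inverse (cnj z) = z"
  by (metis complex_norm_square inverse_unique mult.commute of_real_1 one_power2)

lemma inverse_cnj_in_sym_annulus:
  assumes "R > 1" "z \<in> sym_annulus R"
  shows "inverse (cnj z) \<in> sym_annulus R"
proof -
  have "cmod z > 0" using sym_annulus_nonzero[OF assms] by simp
  then show ?thesis
    using assms by (simp add: annulus_def norm_divide inverse_eq_divide divide_simps mult.commute)
qed

text \<open>This is Schwarz reflection: it keeps functions holomorphic and realises the conjugate of
  \<open>f\<close> on the circle by a holomorphic function.\<close>

definition reflect :: "(complex \<Rightarrow> complex) \<Rightarrow> complex \<Rightarrow> complex" where
  "reflect f z = cnj (f (inverse (cnj z)))"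

lemma reflect_unit: "cmod z = 1 \<Longrightarrow> reflect f z = cnj (f z)"
  by (simp add: reflect_def inverse_cnj_unit)

text \<open>Two conjugations make \<open>cnj \<circ> f \<circ> cnj\<close> complex differentiable;
  the chain rule with \<open>inverse\<close> supplies the remaining factor.\<close>

lemma reflect_has_field_derivative:
  assumes "z \<noteq> 0" "(f has_field_derivative f') (at (inverse (cnj z)))"
  shows "(reflect f has_field_derivative - cnj f' / z\<^sup>2) (at z)"
proof -
  have "((cnj \<circ> f \<circ> cnj) has_field_derivative cnj f') (at (inverse z))"
    using assms(2) has_field_derivative_cnj_cnj[of f f' "inverse z"] by simp
  moreover have "(inverse has_field_derivative - inverse (z\<^sup>2)) (at z)"
    using assms(1) by (auto intro!: derivative_eq_intros simp: power2_eq_square)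
  ultimately have "((cnj \<circ> f \<circ> cnj) \<circ> inverse has_field_derivative cnj f' * - inverse (z\<^sup>2)) (at z)"
    by (rule DERIV_chain)
  moreover have "(cnj \<circ> f \<circ> cnj) \<circ> inverse = reflect f" by (auto simp: reflect_def)
  ultimately show ?thesis by (simp add: divide_inverse)
qed

lemma reflect_holomorphic:
  assumes "R > 1" "f holomorphic_on sym_annulus R"
  shows "reflect f holomorphic_on sym_annulus R"
proof -
  have "reflect f field_differentiable at z" if z: "z \<in> sym_annulus R" for z
  proof -
    have "f field_differentiable at (inverse (cnj z))"
      using holomorphic_on_imp_differentiable_at[OF assms(2) open_annulus inverse_cnj_in_sym_annulus[OF assms(1) z]] .
    then show ?thesis
      using reflect_has_field_derivative sym_annulus_nonzero[OF assms(1) z] unfolding field_differentiable_def by blast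
  qed
  then show ?thesis
    by (simp add: holomorphic_on_def field_differentiable_at_within)
qed

text \<open>Two logarithms of the same number differ by a period, so \<open>N\<close> depends only
  on \<open>exp (i w)\<close>. Since \<open>cmod (exp (i w)) = exp (- Im w)\<close>, the bounds of
  the strip swap.\<close>

lemma descend_exp:
  fixes N :: "complex \<Rightarrow> complex"
  assumes hol: "N holomorphic_on {w. a < Im w \<and> Im w < b}"
    and per: "\<And>w. a < Im w \<Longrightarrow> Im w < b \<Longrightarrow> N (w + 2 * pi) = N w"
  obtains M where "M holomorphic_on annulus (exp (- b)) (exp (- a))"
    "\<And>w. a < Im w \<Longrightarrow> Im w < b \<Longrightarrow> M (exp (\<i> * w)) = N w"
proof -
  let ?S = "{w. a < Im w \<and> Im w < b}"
  \<comment> \<open>Extension by zero makes the periodicity hold for every \<open>w\<close>, as the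
    locale requires.\<close>
  define N' where "N' w = (if w \<in> ?S then N w else 0)" for w
  interpret periodic_fun_simple N' "2 * complex_of_real pi"
    using per by unfold_locales (simp add: N'_def)
  have eqN: "N' w = N' w'" if ww: "exp (\<i> * w) = exp (\<i> * w')" for w w'
  proof -
    obtain n :: int where "\<i> * w = \<i> * w' + of_real (of_int (2 * n) * pi) * \<i>"
      using ww unfolding exp_eq by blast
    then have "\<i> * w = \<i> * (w' + of_int n * (2 * pi))" by (simp add: algebra_simps)
    then have "w = w' + of_int n * (2 * pi)" by simp
    then show ?thesis using plus_of_int[of w' n] by simp
  qed
  define M where "M z = N' (- \<i> * Ln z)" for z
  have M: "M (exp (\<i> * w)) = N' w" for w
    unfolding M_def by (intro eqN) simp
  have oS: "open ?S" by (intro open_Collect_conj open_Collect_less continuous_intros)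
  have holN': "N' holomorphic_on ?S" using hol by (rule holomorphic_transform) (simp add: N'_def)
  have "M field_differentiable at z" if z: "z \<in> annulus (exp (- b)) (exp (- a))" for z
  proof -
    have "z \<noteq> 0" using z by (auto simp: annulus_def)
    \<comment> \<open>A branch of \<open>-i log\<close> centred at \<open>z\<close>: it is
      differentiable there even if \<open>z\<close> lies on the cut of \<open>Ln\<close>, and
      \<open>N'\<close> does not see the change of branch.\<close>
    define lg where "lg x = - \<i> * Ln z - \<i> * Ln (x / z)" for x
    have ex: "exp (\<i> * lg x) = x" if "x \<noteq> 0" for x
      using that \<open>z \<noteq> 0\<close> by (simp add: lg_def algebra_simps exp_add)
    have "Im (lg z) = - ln (cmod z)" using \<open>z \<noteq> 0\<close> by (simp add: lg_def)
    moreover have "- b < ln (cmod z)" "ln (cmod z) < - a"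
      using z \<open>z \<noteq> 0\<close> unfolding annulus_def
      by (metis (no_types, lifting) exp_less_cancel_iff exp_ln mem_Collect_eq zero_less_norm_iff)+
    ultimately have "lg z \<in> ?S" by auto
    then have "N' field_differentiable at (lg z)"
      using holomorphic_on_imp_differentiable_at[OF holN' oS] by blast
    moreover have "lg field_differentiable at z"
      unfolding lg_def using \<open>z \<noteq> 0\<close>
      by (auto intro!: derivative_eq_intros simp: field_differentiable_def)
    ultimately have "(N' \<circ> lg) field_differentiable at z"
      by (intro field_differentiable_compose)
    moreover have "eventually (\<lambda>x. (N' \<circ> lg) x = M x) (nhds z)"
    proof -
      have "eventually (\<lambda>x. x \<noteq> 0) (nhds z)"
        using \<open>z \<noteq> 0\<close> by (rule t1_space_nhds)
      then show ?thesis by eventually_elim (metis M ex comp_apply)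
    qed
    ultimately show ?thesis
      unfolding field_differentiable_def by (metis DERIV_cong_ev)
  qed
  then have "M holomorphic_on annulus (exp (- b)) (exp (- a))"
    by (simp add: holomorphic_on_def field_differentiable_at_within)
  then show ?thesis using that M by (simp add: N'_def)
qed

text \<open>Under \<open>z = exp (i w)\<close> the form \<open>dz / z\<close> becomes
  \<open>i dw\<close>, and a primitive exists on the convex strip. Its increment over a period is
  removed by subtracting a linear term, and the periodic remainder descends to the annulus.\<close>

lemma primitive_on_sym_annulus:
  assumes "R > 1" "l holomorphic_on sym_annulus R"
  obtains M a where "\<And>z. z \<in> sym_annulus R \<Longrightarrow> (M has_field_derivative (l z - a) / z) (at z)"
proof -
  define S where "S = {w. - ln R < Im w \<and> Im w < ln R}"
  have oS: "open S" unfolding S_def by (intro open_Collect_conj open_Collect_less continuous_intros)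
  have cS: "convex S"
  proof -
    have "S = {w. Im w < ln R} \<inter> {w. Im w > - ln R}" by (auto simp: S_def)
    then show ?thesis
      by (simp add: convex_Int convex_halfspace_Im_lt convex_halfspace_Im_gt)
  qed
  have exp_mem: "exp (\<i> * w) \<in> sym_annulus R \<longleftrightarrow> w \<in> S" for w
  proof -
    have "R = exp (ln R)" using assms(1) by simp
    then show ?thesis by (smt (verit) S_def annulus_def Re_i_times exp_less_cancel_iff exp_minus inverse_eq_divide mem_Collect_eq norm_exp_eq_Re)
  qed
  have eq: "sym_annulus R = annulus (exp (- ln R)) (exp (- (- ln R)))"
    using assms(1) by (simp add: exp_minus inverse_eq_divide)
  have "(\<lambda>w. l (exp (\<i> * w))) holomorphic_on S"
    using holomorphic_on_compose_gen[OF _ assms(2), of "\<lambda>w. exp (\<i> * w)" S] exp_mem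
    by (auto simp: o_def intro!: holomorphic_intros)
  then obtain P where P: "\<And>w. w \<in> S \<Longrightarrow> (P has_field_derivative l (exp (\<i> * w))) (at w)"
    using holomorphic_convex_primitive'[OF cS oS] oS by (metis at_within_open)
  have per: "w + 2 * pi \<in> S \<longleftrightarrow> w \<in> S" for w :: complex by (simp add: S_def)
  have ee: "exp (\<i> * (w + 2 * pi)) = exp (\<i> * w)" for w :: complex
    by (simp add: algebra_simps exp_add)
  have "((\<lambda>w. P (w + 2 * pi) - P w) has_field_derivative 0) (at w)" if "w \<in> S" for w
  proof -
    have "(P has_field_derivative l (exp (\<i> * w))) (at (w + 2 * pi))"
      using P[OF per[THEN iffD2, OF that]] unfolding ee .
    then have "((\<lambda>w. P (w + 2 * pi)) has_field_derivative l (exp (\<i> * w))) (at w)"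
      by (simp only: DERIV_shift)
    from DERIV_diff[OF this P[OF that]] show ?thesis by simp
  qed
  then have "\<exists>k. \<forall>w\<in>S. P (w + 2 * pi) - P w = k"
    using cS by (intro has_field_derivative_zero_constant) (auto intro: has_field_derivative_at_within)
  then obtain k where k: "\<And>w. w \<in> S \<Longrightarrow> P (w + 2 * pi) - P w = k" by blast
  \<comment> \<open>The mean of \<open>l\<close> over a period, that is, the residue of
    \<open>l z / z\<close> at the hole.\<close>
  define a where "a = k / (2 * pi)"
  define N where "N w = \<i> * (P w - a * w)" for w
  have N': "(N has_field_derivative \<i> * (l (exp (\<i> * w)) - a)) (at w)" if "w \<in> S" for w
    unfolding N_def using P[OF that] by (auto intro!: derivative_eq_intros)
  have Nhol: "N holomorphic_on {w. - ln R < Im w \<and> Im w < ln R}"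
    using N' oS by (auto simp: holomorphic_on_open S_def)
  have Nper: "N (w + 2 * pi) = N w" if "- ln R < Im w" "Im w < ln R" for w
  proof -
    have "a * (2 * pi) = k" by (simp add: a_def)
    moreover have "P (w + 2 * pi) = P w + k" using k[of w] that by (simp add: S_def algebra_simps)
    ultimately show ?thesis by (simp add: N_def distrib_left)
  qed
  obtain M where "M holomorphic_on annulus (exp (- ln R)) (exp (- (- ln R)))"
    and MN: "\<And>w. - ln R < Im w \<Longrightarrow> Im w < ln R \<Longrightarrow> M (exp (\<i> * w)) = N w"
    by (rule descend_exp[OF Nhol]) (use Nper that in blast)+
  then have M: "M holomorphic_on sym_annulus R" by (simp only: eq)
  have "(M has_field_derivative (l z - a) / z) (at z)" if z: "z \<in> sym_annulus R" for z
  proof -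
    have "z \<noteq> 0" using sym_annulus_nonzero assms(1) z .
    define w where "w = - \<i> * Ln z"
    have zw: "z = exp (\<i> * w)" using \<open>z \<noteq> 0\<close> by (simp add: w_def)
    then have w: "w \<in> S" using z exp_mem by simp
    obtain M' where M': "(M has_field_derivative M') (at z)"
      using holomorphic_on_imp_differentiable_at[OF M open_annulus z] by (auto simp: field_differentiable_def)
    \<comment> \<open>The derivative of \<open>M (exp (i w))\<close> is computed both by the chain
      rule and from \<open>N\<close>.\<close>
    have "((\<lambda>w. M (exp (\<i> * w))) has_field_derivative M' * (\<i> * z)) (at w)"
    proof (rule DERIV_chain'[of "\<lambda>w. exp (\<i> * w)"])
      show "((\<lambda>w. exp (\<i> * w)) has_field_derivative \<i> * z) (at w)"
        by (auto intro!: derivative_eq_intros simp: zw)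
      show "(M has_field_derivative M') (at (exp (\<i> * w)))" using M' zw by simp
    qed
    moreover have "((\<lambda>w. M (exp (\<i> * w))) has_field_derivative \<i> * (l z - a)) (at w)"
    proof (rule has_field_derivative_transform_within_open[OF _ oS w])
      show "(N has_field_derivative \<i> * (l z - a)) (at w)" using N'[OF w] zw by simp
    qed (use MN in \<open>simp add: S_def\<close>)
    ultimately have "M' * (\<i> * z) = \<i> * (l z - a)" by (rule DERIV_unique)
    then have "\<i> * (M' * z) = \<i> * (l z - a)" by (simp only: mult.left_commute)
    then have "M' = (l z - a) / z" using \<open>z \<noteq> 0\<close> by (simp add: eq_divide_eq)
    then show ?thesis using M' by simp
  qed
  then show ?thesis by (rule that)
qed

text \<open>Locally this is the real part of a logarithm, whose derivative is \<open>1 / z\<close>;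
  unlike the logarithm it is single-valued on the annulus.\<close>

lemma ln_cmod_has_derivative:
  assumes "z \<noteq> 0"
  shows "((\<lambda>z. ln (cmod z)) has_derivative (\<lambda>v. Re (v / z))) (at z)"
proof -
  have "((\<lambda>z. ln (cmod z)) has_derivative (\<lambda>v. inverse (cmod z) * (v \<bullet> sgn z))) (at z)"
    using assms by (auto intro!: derivative_eq_intros has_derivative_norm)
  moreover have "inverse (cmod z) * (v \<bullet> sgn z) = Re (v / z)" for v
    using assms by (simp add: complex_div_cnj[of v z] inner_complex_def sgn_div_norm power2_eq_square field_simps)
  ultimately show ?thesis by simp
qed

text \<open>d'Alembert's formula in the coordinate \<open>log z\<close>: the solution is the mean of \<open>c\<close> over \<open>z\<close> and
  its reflection plus half the integral of \<open>l z / z\<close> between them. The residue of \<open>l z / z\<close>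
  contributes the logarithmic term.\<close>

lemma harmonic_on_sym_annulus_with_cauchy_data:
  assumes R: "R > 1" and c: "c holomorphic_on sym_annulus R" and l: "l holomorphic_on sym_annulus R"
  obtains h where
    "\<And>z. z \<in> sym_annulus R \<Longrightarrow> (h has_derivative (\<lambda>v. (l z / z + deriv c z) / 2 * v +
        cnj ((reflect l z / z + deriv (reflect c) z) / 2 * v))) (at z)"
    "\<And>z. cmod z = 1 \<Longrightarrow> h z = c z"
proof -
  obtain M a where M: "\<And>z. z \<in> sym_annulus R \<Longrightarrow> (M has_field_derivative (l z - a) / z) (at z)"
    using primitive_on_sym_annulus[OF R l] by metis
  define h where "h z = 1 / 2 * (c z + cnj (reflect c z) + M z - cnj (reflect M z)) + a * ln (cmod z)" for z
  have "(h has_derivative (\<lambda>v. (l z / z + deriv c z) / 2 * v +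
        cnj ((reflect l z / z + deriv (reflect c) z) / 2 * v))) (at z)" if z: "z \<in> sym_annulus R" for z
  proof -
    have nz: "z \<noteq> 0" using sym_annulus_nonzero R z .
    have c': "(c has_field_derivative deriv c z) (at z)"
      using holomorphic_derivI[OF c open_annulus z] .
    have sc': "(reflect c has_field_derivative deriv (reflect c) z) (at z)"
      using holomorphic_derivI[OF reflect_holomorphic[OF R c] open_annulus z] .
    have "- cnj ((l (inverse (cnj z)) - a) / inverse (cnj z)) / z\<^sup>2 = - (reflect l z - cnj a) / z"
      using nz by (simp add: reflect_def field_simps power2_eq_square)
    then have sM': "(reflect M has_field_derivative - (reflect l z - cnj a) / z) (at z)"
      using reflect_has_field_derivative[OF nz M[OF inverse_cnj_in_sym_annulus[OF R z]]] by simp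
    note D = c'[unfolded has_field_derivative_def] M[OF z, unfolded has_field_derivative_def]
      has_derivative_cnj[OF sc'[unfolded has_field_derivative_def]]
      has_derivative_cnj[OF sM'[unfolded has_field_derivative_def]]
      has_derivative_of_real[OF ln_cmod_has_derivative[OF nz]]
    have "(h has_derivative (\<lambda>v. 1 / 2 * (deriv c z * v + cnj (deriv (reflect c) z * v) + (l z - a) / z * v
        - cnj (- (reflect l z - cnj a) / z * v)) + a * of_real (Re (v / z)))) (at z)"
      unfolding h_def
      by (intro has_derivative_add has_derivative_diff has_derivative_mult_right D)
    \<comment> \<open>The logarithmic term contributes \<open>a / 2\<close> times
      \<open>v / z + cnj (v / z)\<close>, which cancels the residue subtracted in \<open>M\<close>
      and in its reflection.\<close>
    moreover have "1 / 2 * (deriv c z * v + cnj (deriv (reflect c) z * v) + (l z - a) / z * v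
        - cnj (- (reflect l z - cnj a) / z * v)) + a * of_real (Re (v / z)) =
      (l z / z + deriv c z) / 2 * v + cnj ((reflect l z / z + deriv (reflect c) z) / 2 * v)" for v
    proof -
      have "2 * of_real (Re (v / z)) = v / z + cnj (v / z)" by (simp only: complex_add_cnj of_real_mult of_real_numeral)
      then have "of_real (Re (v / z)) = (v / z + cnj (v / z)) / 2"
        by (metis nonzero_mult_div_cancel_left zero_neq_numeral)
      then show ?thesis using nz by (simp add: field_simps)
    qed
    ultimately show ?thesis by simp
  qed
  \<comment> \<open>On the circle the reflected terms return \<open>c z\<close> and
    \<open>M z\<close>, so the two \<open>M\<close> terms cancel, and
    \<open>ln 1 = 0\<close>.\<close>
  moreover have "h z = c z" if "cmod z = 1" for z
    using that by (simp add: h_def reflect_unit)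
  ultimately show ?thesis using that by blast
qed

section \<open>Generalised maximal surfaces and uniqueness\<close>

lemma Ck_on_cong:
  assumes "open S" "\<And>x. x \<in> S \<Longrightarrow> f x = g x"
  shows "Ck_on k f S \<longleftrightarrow> Ck_on k g S"
  using assms(2)
proof (induction k arbitrary: f g)
  case 0
  then show ?case by (simp cong: continuous_on_cong)
next
  case (Suc k)
  have "(f has_derivative D) (at x) \<longleftrightarrow> (g has_derivative D) (at x)" if "x \<in> S" for D x
    using has_derivative_transform_within_open[OF _ assms(1) that, of f D UNIV g]
      has_derivative_transform_within_open[OF _ assms(1) that, of g D UNIV f] Suc.prems by auto
  then have "f differentiable (at x) \<longleftrightarrow> g differentiable (at x)"
    and fr: "frechet_derivative f (at x) = frechet_derivative g (at x)" if "x \<in> S" for x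
    using that by (auto simp: differentiable_def frechet_derivative_def)
  moreover have "Ck_on k (\<lambda>x. frechet_derivative f (at x) v) S \<longleftrightarrow>
      Ck_on k (\<lambda>x. frechet_derivative g (at x) v) S" for v
    using fr by (intro Suc.IH) simp
  ultimately show ?case by simp
qed

lemma holomorphic_parts_has_derivative:
  assumes "open S" "a holomorphic_on S" "b holomorphic_on S" "c holomorphic_on S" "z \<in> S"
  shows "((\<lambda>z. (a z + cnj (b z), Re (c z))) has_derivative
    (\<lambda>v. (deriv a z * v + cnj (deriv b z * v), Re (deriv c z * v)))) (at z)"
proof -
  note H = holomorphic_derivI[OF _ assms(1,5), unfolded has_field_derivative_def]
  show ?thesis
    by (intro has_derivative_Pair has_derivative_add has_derivative_cnj
        bounded_linear.has_derivative[OF bounded_linear_Re] H assms(2-4))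
qed

text \<open>This class of maps is closed under directional derivatives: each holomorphic part is
  replaced by its derivative times \<open>v\<close>. Hence the induction on \<open>k\<close> over
  arbitrary parts.\<close>

lemma Ck_on_holomorphic_parts:
  assumes "open S" "a holomorphic_on S" "b holomorphic_on S" "c holomorphic_on S"
  shows "Ck_on k (\<lambda>z. (a z + cnj (b z), Re (c z))) S"
  using assms(2-)
proof (induction k arbitrary: a b c)
  case 0
  then have "continuous_on S a" "continuous_on S b" "continuous_on S c"
    by (auto intro: holomorphic_on_imp_continuous_on)
  then show ?case by (auto intro!: continuous_intros)
next
  case (Suc k)
  note D = holomorphic_parts_has_derivative[OF assms(1) Suc.prems]
  have "Ck_on k (\<lambda>z. frechet_derivative (\<lambda>z. (a z + cnj (b z), Re (c z))) (at z) v) S" for v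
  proof -
    have "Ck_on k (\<lambda>z. (deriv a z * v + cnj (deriv b z * v), Re (deriv c z * v))) S"
      using Suc.prems assms(1) by (intro Suc.IH holomorphic_intros) auto
    moreover have "frechet_derivative (\<lambda>z. (a z + cnj (b z), Re (c z))) (at z) v =
        (deriv a z * v + cnj (deriv b z * v), Re (deriv c z * v))" if "z \<in> S" for z
      using frechet_derivative_at[OF D[OF that]] by metis
    ultimately show ?thesis
      using Ck_on_cong[OF assms(1)] by (smt (verit, best))
  qed
  then show ?case using D by (auto simp: differentiable_def)
qed

lemma dz_dzbar_unique:
  assumes "(f has_derivative (\<lambda>v. p * v + cnj (q * v))) (at z)"
  shows "dz f z = p" "dzbar f z = cnj q"
proof -
  have "frechet_derivative f (at z) = (\<lambda>v. p * v + cnj (q * v))"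
    using frechet_derivative_at[OF assms] by simp
  then show "dz f z = p" "dzbar f z = cnj q"
    by (simp_all add: dz_def dzbar_def field_simps)
qed

text \<open>Because of logarithmic terms, \<open>F\<close> itself need not split globally into
  holomorphic and antiholomorphic parts on an annulus. Its derivative does, so one order is peeled
  off first.\<close>

lemma smooth_on_harmonic:
  assumes S: "open S" and p: "p holomorphic_on S" and q: "q holomorphic_on S" and m: "m holomorphic_on S"
    and D: "\<And>z. z \<in> S \<Longrightarrow> (F has_derivative (\<lambda>v. (p z * v + cnj (q z * v), Re (m z * v)))) (at z)"
  shows "smooth_on F S"
  unfolding smooth_on_def
proof
  fix k
  show "Ck_on k F S"
  proof (cases k)
    case 0
    have "continuous_on S F"
      using D by (meson continuous_at_imp_continuous_on has_derivative_continuous)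
    then show ?thesis using 0 by simp
  next
    case (Suc j)
    have "Ck_on j (\<lambda>z. frechet_derivative F (at z) v) S" for v
    proof -
      have "Ck_on j (\<lambda>z. (p z * v + cnj (q z * v), Re (m z * v))) S"
        by (intro Ck_on_holomorphic_parts S holomorphic_intros p q m)
      moreover have "frechet_derivative F (at z) v = (p z * v + cnj (q z * v), Re (m z * v))"
        if "z \<in> S" for z
        using frechet_derivative_at[OF D[OF that]] by metis
      ultimately show ?thesis
        using Ck_on_cong[OF S] by (smt (verit, best))
    qed
    then show ?thesis using D Suc by (auto simp: differentiable_def)
  qed
qed

lemma dzbar_holomorphic_eq_0:
  assumes "open S" "p holomorphic_on S" "\<And>z. z \<in> S \<Longrightarrow> f z = p z" "z \<in> S"
  shows "dzbar f z = 0"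
proof -
  have "(p has_derivative (*) (deriv p z)) (at z)"
    using holomorphic_derivI[OF assms(2,1,4)] by (simp add: has_field_derivative_def)
  then have "(f has_derivative (*) (deriv p z)) (at z)"
    using has_derivative_transform_within_open[OF _ assms(1,4), of p _ UNIV f] assms(3) by simp
  then show ?thesis using dz_dzbar_unique(2)[of f "deriv p z" 0 z] by simp
qed

text \<open>Here \<open>p\<close> is \<open>h\<^sub>z\<close>, \<open>q\<close> is the conjugate of the \<open>zbar\<close>-derivative of \<open>h\<close>, and \<open>m\<close> is \<open>w\<^sub>z\<close>.\<close>

lemma generalised_maximal_surfaceI:
  assumes S: "open S" "connected S"
    and p: "p holomorphic_on S" and q: "q holomorphic_on S" and m: "m holomorphic_on S"
    and D: "\<And>z. z \<in> S \<Longrightarrow> (F has_derivative (\<lambda>v. (p z * v + cnj (q z * v), 2 * Re (m z * v)))) (at z)"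
    and conf: "\<And>z. z \<in> S \<Longrightarrow> p z * q z = (m z)\<^sup>2"
    and nondeg: "\<not> (\<forall>z\<in>S. cmod (p z) = cmod (q z))"
  shows "generalised_maximal_surface S F"
    and "z \<in> S \<Longrightarrow> dz (hpart F) z = p z" "z \<in> S \<Longrightarrow> dzbar (hpart F) z = cnj (q z)"
proof -
  have h: "(hpart F has_derivative (\<lambda>v. p z * v + cnj (q z * v))) (at z)" if "z \<in> S" for z
    using has_derivative_fst[OF D[OF that]] by simp
  \<comment> \<open>Writing twice the real part as a sum of conjugates shows that both coefficients
    of the real component are \<open>m\<close>.\<close>
  have w: "(wpart F has_derivative (\<lambda>v. m z * v + cnj (m z * v))) (at z)" if "z \<in> S" for z
  proof -
    have "(wpart F has_derivative (\<lambda>v. of_real (2 * Re (m z * v)))) (at z)"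
      using has_derivative_of_real[OF has_derivative_snd[OF D[OF that]]] by simp
    then show ?thesis by (simp only: complex_add_cnj)
  qed
  note hz = dz_dzbar_unique[OF h] and wz = dz_dzbar_unique[OF w]
  show "z \<in> S \<Longrightarrow> dz (hpart F) z = p z" "z \<in> S \<Longrightarrow> dzbar (hpart F) z = cnj (q z)" for z
    using hz by auto
  have "smooth_on F S"
    using D by (intro smooth_on_harmonic[OF S(1) p q, of "\<lambda>z. 2 * m z"] holomorphic_intros m)
      (auto simp: mult.assoc)
  moreover have "dzbar (dz (hpart F)) z = 0" "dzbar (dz (wpart F)) z = 0" if "z \<in> S" for z
    using dzbar_holomorphic_eq_0[OF S(1) p hz(1) that] dzbar_holomorphic_eq_0[OF S(1) m wz(1) that]
    by auto
  ultimately show "generalised_maximal_surface S F"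
    unfolding generalised_maximal_surface_def
    using S hz wz conf nondeg by simp
qed

text \<open>Vanishing of \<open>dzbar f z\<close> is the Cauchy-Riemann equation: the real
  derivative commutes with multiplication by i and is therefore complex linear.\<close>

lemma cr_has_field_derivative:
  assumes "f differentiable (at z)" "dzbar f z = 0"
  shows "(f has_field_derivative dz f z) (at z)"
proof -
  let ?D = "frechet_derivative f (at z)"
  have D: "(f has_derivative ?D) (at z)" using assms(1) frechet_derivative_works by blast
  then have lin: "linear ?D" using has_derivative_linear by blast
  have i: "?D \<i> = \<i> * ?D 1"
  proof -
    have "?D 1 + \<i> * ?D \<i> = 0" using assms(2) by (simp add: dzbar_def)
    then have "\<i> * (?D 1 + \<i> * ?D \<i>) = 0" by simp
    then show ?thesis by (simp add: algebra_simps)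
  qed
  have "?D v = dz f z * v" for v
  proof -
    have "v = Re v *\<^sub>R 1 + Im v *\<^sub>R \<i>"
      by (simp add: complex_eq_iff)
    then have "?D v = ?D (Re v *\<^sub>R 1 + Im v *\<^sub>R \<i>)" by (rule arg_cong)
    also have "\<dots> = Re v *\<^sub>R ?D 1 + Im v *\<^sub>R ?D \<i>"
      using lin by (simp only: linear_add linear_scale)
    also have "\<dots> = ?D 1 * v"
      by (simp add: i complex_eq_iff)
    also have "?D 1 = dz f z" by (simp add: dz_def i)
    finally show ?thesis .
  qed
  then have "?D = (*) (dz f z)" by auto
  then show ?thesis using D by (simp add: has_field_derivative_def)
qed

text \<open>A harmonic function with vanishing Cauchy data: \<open>f\<^sub>z\<close> is holomorphic and vanishes on
  the circle, so it vanishes; then the conjugate of \<open>f\<close> is holomorphic and vanishes on the circle.\<close>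

lemma harmonic_zero_cauchy_data:
  assumes S: "open S" "connected S" "sphere 0 1 \<subseteq> S"
    and f: "\<And>z. z \<in> S \<Longrightarrow> f differentiable (at z)"
    and df: "\<And>z. z \<in> S \<Longrightarrow> dz f differentiable (at z)"
    and harm: "\<And>z. z \<in> S \<Longrightarrow> dzbar (dz f) z = 0"
    and f0: "\<And>z. cmod z = 1 \<Longrightarrow> f z = 0"
    and df0: "\<And>z. cmod z = 1 \<Longrightarrow> (f has_derivative (\<lambda>_. 0)) (at z)"
    and z: "z \<in> S"
  shows "f z = 0"
proof -
  have 1: "1 \<in> S" "cmod 1 = 1" using S(3) by auto
  have "dz f holomorphic_on S"
    using cr_has_field_derivative[OF df harm] S(1) by (auto simp: holomorphic_on_open)
  moreover have "dz f z = 0" if "cmod z = 1" for z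
    using dz_dzbar_unique(1)[of f 0 0] df0[OF that] by simp
  ultimately have dz0: "dz f z = 0" if "z \<in> S" for z
    using holomorphic_eq_if_eq_on_circle[OF S(1,2) 1, of "dz f" "\<lambda>_. 0" z] that by simp
  have "(cnj \<circ> f) field_differentiable at z" if "z \<in> S" for z
  proof -
    let ?D = "frechet_derivative f (at z)"
    have D: "(f has_derivative ?D) (at z)" using f[OF that] frechet_derivative_works by blast
    have "((cnj \<circ> f) has_derivative (\<lambda>v. cnj (?D v))) (at z)"
      using has_derivative_cnj[OF D] by (simp add: o_def)
    then have fr: "frechet_derivative (cnj \<circ> f) (at z) = (\<lambda>v. cnj (?D v))"
      and d: "(cnj \<circ> f) differentiable (at z)"
      using frechet_derivative_at differentiableI by metis+
    have "dzbar (cnj \<circ> f) z = cnj (dz f z)"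
      by (simp add: dzbar_def dz_def fr)
    then have "dzbar (cnj \<circ> f) z = 0" using dz0[OF that] by simp
    from cr_has_field_derivative[OF d this] show ?thesis by (auto simp: field_differentiable_def)
  qed
  then have "cnj \<circ> f holomorphic_on S"
    by (simp add: holomorphic_on_def field_differentiable_at_within)
  then have "(cnj \<circ> f) z = 0"
    using holomorphic_eq_if_eq_on_circle[OF S(1,2) 1, of "cnj \<circ> f" "\<lambda>_. 0" z] z f0 by simp
  then show ?thesis by simp
qed

lemma dz_diff:
  assumes "f differentiable (at z)" "g differentiable (at z)"
  shows "dz (\<lambda>z. f z - g z) z = dz f z - dz g z" "dzbar (\<lambda>z. f z - g z) z = dzbar f z - dzbar g z"
proof -
  have "((\<lambda>z. f z - g z) has_derivative (\<lambda>v. frechet_derivative f (at z) v - frechet_derivative g (at z) v)) (at z)"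
    using assms by (intro has_derivative_diff) (simp_all add: frechet_derivative_works)
  from frechet_derivative_at[OF this, symmetric]
  show "dz (\<lambda>z. f z - g z) z = dz f z - dz g z" "dzbar (\<lambda>z. f z - g z) z = dzbar f z - dzbar g z"
    by (simp_all add: dz_def dzbar_def field_simps)
qed

lemma differentiable_transform_open:
  assumes "open S" "z \<in> S" "\<And>x. x \<in> S \<Longrightarrow> f x = g x" "f differentiable (at z)"
  shows "g differentiable (at z)"
  using assms has_derivative_transform_within_open[of f _ z UNIV S g]
  unfolding differentiable_def by (metis)

lemma dzbar_cong:
  assumes "open S" "z \<in> S" "\<And>x. x \<in> S \<Longrightarrow> f x = g x"
  shows "dzbar f z = dzbar g z"
proof -
  have "(f has_derivative D) (at z) \<longleftrightarrow> (g has_derivative D) (at z)" for D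
    using has_derivative_transform_within_open[OF _ assms(1,2), of f D UNIV g]
      has_derivative_transform_within_open[OF _ assms(1,2), of g D UNIV f] assms(3) by auto
  then show ?thesis by (simp add: dzbar_def frechet_derivative_def)
qed

text \<open>The map \<open>T\<close> stands for either component of \<open>F\<close>, made
  complex-valued; two orders of smoothness give both claims.\<close>

lemma smooth_on_dz_differentiable:
  assumes S: "open S" "smooth_on F S" "z \<in> S" and T: "bounded_linear T"
  shows "(\<lambda>z. T (F z)) differentiable (at z)" "dz (\<lambda>z. T (F z)) differentiable (at z)"
proof -
  have "Ck_on (Suc (Suc 0)) F S" using assms(2) unfolding smooth_on_def by blast
  then have d1: "\<And>x. x \<in> S \<Longrightarrow> F differentiable (at x)"
    and d2: "\<And>x v. x \<in> S \<Longrightarrow> (\<lambda>x. frechet_derivative F (at x) v) differentiable (at x)"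
    by auto
  have D: "((\<lambda>z. T (F z)) has_derivative (\<lambda>v. T (frechet_derivative F (at x) v))) (at x)"
    if "x \<in> S" for x
    using d1[OF that] by (intro bounded_linear.has_derivative[OF T]) (simp add: frechet_derivative_works)
  then show "(\<lambda>z. T (F z)) differentiable (at z)"
    using S(3) by (auto simp: differentiable_def)
  have Td: "(\<lambda>x. T (frechet_derivative F (at x) v)) differentiable (at z)" for v
    using d2[OF S(3), of v] bounded_linear.has_derivative[OF T] unfolding differentiable_def by blast
  have "(\<lambda>x. (T (frechet_derivative F (at x) 1) - \<i> * T (frechet_derivative F (at x) \<i>)) / 2)
      differentiable (at z)"
    by (intro derivative_intros Td) simp
  moreover have "dz (\<lambda>z. T (F z)) x =
      (T (frechet_derivative F (at x) 1) - \<i> * T (frechet_derivative F (at x) \<i>)) / 2" if "x \<in> S" for x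
    using frechet_derivative_at[OF D[OF that], symmetric] by (simp add: dz_def)
  ultimately show "dz (\<lambda>z. T (F z)) differentiable (at z)"
    using differentiable_transform_open[OF S(1,3)] by (metis (no_types, lifting))
qed

section \<open>Derivatives along the circle and along rays\<close>

lemma cis_has_vector_derivative: "(cis has_vector_derivative \<i> * cis \<theta>) (at \<theta>)"
  using has_derivative_cis[of "\<lambda>x. x" "\<lambda>x. x" \<theta> UNIV]
  by (simp add: has_vector_derivative_def scaleR_conv_of_real mult_ac)

lemma radial_has_vector_derivative:
  assumes "(f has_derivative D) (at (cis \<theta>))"
  shows "((\<lambda>\<rho>. f (complex_of_real \<rho> * cis \<theta>)) has_vector_derivative D (cis \<theta>)) (at 1)"
proof -
  have "((\<lambda>\<rho>. complex_of_real \<rho> * cis \<theta>) has_vector_derivative cis \<theta>) (at 1)"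
    by (auto intro!: derivative_eq_intros simp: has_vector_derivative_def scaleR_conv_of_real)
  then show ?thesis
    using assms vector_derivative_diff_chain_within[of "\<lambda>\<rho>. complex_of_real \<rho> * cis \<theta>" "cis \<theta>" 1 UNIV f D]
    by (simp add: o_def has_derivative_at_withinI)
qed

text \<open>The radial vector \<open>cis \<theta>\<close> and the tangent
  \<open>i * cis \<theta>\<close> form a real basis. The derivative kills the first by hypothesis
  and the second because \<open>D\<close> vanishes along the circle.\<close>

lemma has_derivative_zero_on_circle:
  fixes D :: "complex \<Rightarrow> 'a::real_normed_vector"
  assumes "D differentiable (at (cis \<theta>))" "\<And>t. D (cis t) = 0"
    and "((\<lambda>\<rho>. D (complex_of_real \<rho> * cis \<theta>)) has_vector_derivative 0) (at 1)"
  shows "(D has_derivative (\<lambda>_. 0)) (at (cis \<theta>))"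
proof -
  let ?z = "cis \<theta>"
  let ?D = "frechet_derivative D (at ?z)"
  have D: "(D has_derivative ?D) (at ?z)" using assms(1) frechet_derivative_works by blast
  then have lin: "linear ?D" using has_derivative_linear by blast
  have rad: "?D ?z = 0"
    using radial_has_vector_derivative[OF D] assms(3) vector_derivative_unique_at by blast
  have "((\<lambda>t. D (cis t)) has_vector_derivative ?D (\<i> * ?z)) (at \<theta>)"
    using D cis_has_vector_derivative
      vector_derivative_diff_chain_within[of cis "\<i> * ?z" \<theta> UNIV D ?D]
    by (simp add: o_def has_derivative_at_withinI)
  moreover have "((\<lambda>t. D (cis t)) has_vector_derivative 0) (at \<theta>)"
    using assms(2) by simp
  ultimately have tang: "?D (\<i> * ?z) = 0" using vector_derivative_unique_at by blast
  have "?D v = 0" for v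
  proof -
    have "v = (v / ?z) * ?z" by simp
    also have "v / ?z = Re (v / ?z) + Im (v / ?z) * \<i>" by (simp add: complex_eq_iff)
    finally have "v = Re (v / ?z) *\<^sub>R ?z + Im (v / ?z) *\<^sub>R (\<i> * ?z)"
      by (simp add: scaleR_conv_of_real algebra_simps)
    then have "?D v = ?D (Re (v / ?z) *\<^sub>R ?z + Im (v / ?z) *\<^sub>R (\<i> * ?z))"
      by (rule arg_cong)
    also have "\<dots> = Re (v / ?z) *\<^sub>R ?D ?z + Im (v / ?z) *\<^sub>R ?D (\<i> * ?z)"
      by (simp only: linear_add[OF lin] linear_scale[OF lin])
    finally show ?thesis by (simp add: rad tang)
  qed
  then show ?thesis using D by (metis (no_types, lifting) ext)
qed

text \<open>On the common annulus the difference of each component is harmonic with zero Cauchy data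
  on the circle.\<close>

theorem bjorling_solution_unique:
  assumes "bjorling_solution \<gamma> L r R F" "bjorling_solution \<gamma> L r' R' F'"
    and z: "z \<in> annulus r R \<inter> annulus r' R'"
  shows "F z = F' z"
proof -
  define S where "S = annulus (max r r') (min R R')"
  have "open S" "connected S" by (simp_all add: S_def)
  moreover have "sphere 0 1 \<subseteq> S"
    using assms by (auto simp: S_def bjorling_solution_def annulus_def)
  moreover have "S \<subseteq> annulus r R" "S \<subseteq> annulus r' R'" "z \<in> S"
    using z by (auto simp: S_def annulus_def)
  ultimately have S: "open S" "connected S" "sphere 0 1 \<subseteq> S" "S \<subseteq> annulus r R"
    "S \<subseteq> annulus r' R'" "z \<in> S" by auto
  have sm: "smooth_on F (annulus r R)" "smooth_on F' (annulus r' R')"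
    using assms by (auto simp: bjorling_solution_def generalised_maximal_surface_def)
  \<comment> \<open>The argument is run once for a linear map \<open>T\<close> and then applied to
    both components.\<close>
  have zero: "T (F z) - T (F' z) = 0"
    if T: "bounded_linear T"
      and h: "\<And>z. z \<in> annulus r R \<Longrightarrow> dzbar (dz (\<lambda>z. T (F z))) z = 0"
      and h': "\<And>z. z \<in> annulus r' R' \<Longrightarrow> dzbar (dz (\<lambda>z. T (F' z))) z = 0"
    for T :: "complex \<times> real \<Rightarrow> complex"
  proof (rule harmonic_zero_cauchy_data[OF S(1-3), of "\<lambda>z. T (F z) - T (F' z)"])
    let ?f = "\<lambda>z. T (F z)" and ?g = "\<lambda>z. T (F' z)"
    have d: "?f differentiable (at z)" "?g differentiable (at z)"
      "dz ?f differentiable (at z)" "dz ?g differentiable (at z)" if "z \<in> S" for z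
    proof -
      have z: "z \<in> annulus r R" "z \<in> annulus r' R'" using S(4,5) that by auto
      show "?f differentiable (at z)" "?g differentiable (at z)"
        "dz ?f differentiable (at z)" "dz ?g differentiable (at z)"
        by (rule smooth_on_dz_differentiable[OF open_annulus sm(1) z(1) T]
          smooth_on_dz_differentiable[OF open_annulus sm(2) z(2) T])+
    qed
    have dzd: "dz ?f z - dz ?g z = dz (\<lambda>z. ?f z - ?g z) z" if "z \<in> S" for z
      using dz_diff(1) d[OF that] by metis
    show fd: "(\<lambda>z. ?f z - ?g z) differentiable (at z)" if "z \<in> S" for z
      using d[OF that] by (intro derivative_intros)
    show "dz (\<lambda>z. ?f z - ?g z) differentiable (at z)" if "z \<in> S" for z
      using d[OF that] by (intro differentiable_transform_open[OF S(1) that dzd] derivative_intros)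
    show "dzbar (dz (\<lambda>z. ?f z - ?g z)) z = 0" if "z \<in> S" for z
    proof -
      have "dzbar (dz (\<lambda>z. ?f z - ?g z)) z = dzbar (\<lambda>z. dz ?f z - dz ?g z) z"
        using dzbar_cong[OF S(1) that dzd] by simp
      also have "\<dots> = 0"
        using dz_diff(2)[OF d(3,4)[OF that]] h[of z] h'[of z] S(4,5) that
        by (simp add: subset_iff)
      finally show ?thesis .
    qed
    have FF: "F (cis t) = F' (cis t)" for t
      using assms by (simp add: bjorling_solution_def)
    show "?f z - ?g z = 0" if "cmod z = 1" for z
      using unit_circle_cis[OF that] FF by auto
    show "((\<lambda>z. ?f z - ?g z) has_derivative (\<lambda>_. 0)) (at z)" if z: "cmod z = 1" for z
    proof -
      obtain t where t: "z = cis t" using unit_circle_cis[OF z] by blast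
      have zS: "cis t \<in> S" using S(3) by auto
      have "((\<lambda>\<rho>. F (complex_of_real \<rho> * cis t)) has_vector_derivative L (cis t)) (at 1)"
        "((\<lambda>\<rho>. F' (complex_of_real \<rho> * cis t)) has_vector_derivative L (cis t)) (at 1)"
        using assms by (auto simp: bjorling_solution_def)
      note V = this[THEN bounded_linear.has_vector_derivative[OF T]]
      from has_vector_derivative_diff[OF V]
      show ?thesis unfolding t
        using FF by (intro has_derivative_zero_on_circle fd zS) auto
    qed
    show "z \<in> S" by fact
  qed
  have "fst (F z) - fst (F' z) = 0"
    using assms by (intro zero bounded_linear_fst)
      (auto simp: bjorling_solution_def generalised_maximal_surface_def)
  moreover have "complex_of_real (snd (F z)) - complex_of_real (snd (F' z)) = 0"
    using assms by (intro zero bounded_linear_compose[OF bounded_linear_of_real bounded_linear_snd])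
      (auto simp: bjorling_solution_def generalised_maximal_surface_def)
  ultimately show ?thesis by (simp add: prod_eq_iff)
qed

section \<open>Existence\<close>

lemma sym_annulus_mono: "R > 1 \<Longrightarrow> R \<le> R' \<Longrightarrow> sym_annulus R \<subseteq> sym_annulus R'"
  by (rule annulus_mono) (simp_all add: frac_le)

lemma circle_analytic_pair_extension:
  fixes f :: "complex \<Rightarrow> complex \<times> real"
  assumes "circle_analytic f"
  obtains R a b where "R > 1" "a holomorphic_on sym_annulus R" "b holomorphic_on sym_annulus R"
    "\<And>z. cmod z = 1 \<Longrightarrow> a z = fst (f z)" "\<And>z. cmod z = 1 \<Longrightarrow> b z = of_real (snd (f z))"
proof -
  have T: "circle_analytic (\<lambda>z. T (f z))" if "bounded_linear T" for T :: "complex \<times> real \<Rightarrow> complex"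
    using real_analytic_bounded_linear[OF that] assms unfolding circle_analytic_def by blast
  obtain R1 a where a: "R1 > 1" "a holomorphic_on sym_annulus R1" "\<And>z. cmod z = 1 \<Longrightarrow> a z = fst (f z)"
    using circle_analytic_extension[OF T[OF bounded_linear_fst]] by metis
  obtain R2 b where b: "R2 > 1" "b holomorphic_on sym_annulus R2" "\<And>z. cmod z = 1 \<Longrightarrow> b z = of_real (snd (f z))"
    using circle_analytic_extension[OF T[OF bounded_linear_compose[OF bounded_linear_of_real bounded_linear_snd]]]
    by metis
  have "sym_annulus (min R1 R2) \<subseteq> sym_annulus R1" "sym_annulus (min R1 R2) \<subseteq> sym_annulus R2"
    using a(1) b(1) by (simp_all add: sym_annulus_mono)
  then show ?thesis
    using a b by (intro that[of "min R1 R2" a b]) (auto intro: holomorphic_on_subset)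
qed

lemma circle_deriv_extension:
  fixes \<gamma> :: "complex \<Rightarrow> complex \<times> real"
  assumes S: "open S" "sphere 0 1 \<subseteq> S" and hol: "a holomorphic_on S" "b holomorphic_on S"
    and a: "\<And>z. cmod z = 1 \<Longrightarrow> a z = fst (\<gamma> z)"
    and b: "\<And>z. cmod z = 1 \<Longrightarrow> b z = of_real (snd (\<gamma> z))"
  shows "\<i> * cis \<theta> * deriv a (cis \<theta>) = fst (circle_deriv \<gamma> \<theta>)"
    and "\<i> * cis \<theta> * deriv b (cis \<theta>) = of_real (snd (circle_deriv \<gamma> \<theta>))"
proof -
  have D: "((\<lambda>t. f (cis t)) has_vector_derivative \<i> * cis \<theta> * deriv f (cis \<theta>)) (at \<theta>)"
    if "f holomorphic_on S" for f
  proof -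
    have "(f has_field_derivative deriv f (cis \<theta>)) (at (cis \<theta>))"
      using S by (intro holomorphic_derivI[OF that S(1)]) auto
    from field_vector_diff_chain_at[OF cis_has_vector_derivative this] show ?thesis
      by (simp add: o_def)
  qed
  \<comment> \<open>Since \<open>b\<close> is real along the circle, so is its tangential
    derivative, which can thus be read as a real third component.\<close>
  let ?b = "\<i> * cis \<theta> * deriv b (cis \<theta>)"
  have "((\<lambda>t. Im (b (cis t))) has_vector_derivative Im ?b) (at \<theta>)"
    by (rule bounded_linear.has_vector_derivative[OF bounded_linear_Im D[OF hol(2)]])
  moreover have "((\<lambda>t. Im (b (cis t))) has_vector_derivative 0) (at \<theta>)"
    using b by simp
  ultimately have "Im ?b = 0" using vector_derivative_unique_at by blast
  then have real: "of_real (Re ?b) = ?b" by (simp add: complex_eq_iff)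
  have "((\<lambda>t. (a (cis t), Re (b (cis t)))) has_vector_derivative
      (\<i> * cis \<theta> * deriv a (cis \<theta>), Re ?b)) (at \<theta>)"
    by (intro has_vector_derivative_Pair D hol
        bounded_linear.has_vector_derivative[OF bounded_linear_Re])
  moreover have "(a (cis t), Re (b (cis t))) = \<gamma> (cis t)" for t
    using a b by (simp add: prod_eq_iff)
  ultimately have "circle_deriv \<gamma> \<theta> = (\<i> * cis \<theta> * deriv a (cis \<theta>), Re ?b)"
    unfolding circle_deriv_def by (simp add: vector_derivative_at)
  then show "\<i> * cis \<theta> * deriv a (cis \<theta>) = fst (circle_deriv \<gamma> \<theta>)"
    "?b = of_real (snd (circle_deriv \<gamma> \<theta>))"
    using real by simp_all
qed

text \<open>By Lagrange's identity the squared determinant of the planar parts is the product of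
  their squared lengths minus their squared inner product; nullity and orthogonality express this
  through the third components, where it vanishes.\<close>

lemma null_orthogonal_collinear:
  assumes "lorentz u u = 0" "lorentz v v = 0" "lorentz u v = 0"
  shows "fst u * cnj (fst v) = fst v * cnj (fst u)"
proof -
  have "(Re (fst u) * Im (fst v) - Im (fst u) * Re (fst v))\<^sup>2 =
      (Re (fst u) * Re (fst u) + Im (fst u) * Im (fst u)) * (Re (fst v) * Re (fst v) + Im (fst v) * Im (fst v))
      - (Re (fst u) * Re (fst v) + Im (fst u) * Im (fst v))\<^sup>2"
    by (simp add: power2_eq_square algebra_simps)
  also have "\<dots> = (snd u * snd u) * (snd v * snd v) - (snd u * snd v)\<^sup>2"
    using assms by (simp add: lorentz_def)
  also have "\<dots> = 0" by (simp add: power2_eq_square)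
  finally have "Re (fst u) * Im (fst v) - Im (fst u) * Re (fst v) = 0" by simp
  then show ?thesis by (simp add: complex_eq_iff algebra_simps)
qed

text \<open>The complex vector \<open>V = v - i u\<close> is null for the bilinear extension of the
  metric. The factors on the left are \<open>V1 + i V2\<close> and \<open>V1 - i V2\<close>.\<close>

lemma null_orthogonal_conformal:
  assumes "lorentz u u = 0" "lorentz v v = 0" "lorentz u v = 0"
  shows "(fst v - \<i> * fst u) * (cnj (fst v) - \<i> * cnj (fst u)) =
    (of_real (snd v) - \<i> * of_real (snd u))\<^sup>2"
proof -
  have r: "Re (fst u) * Re (fst u) = snd u * snd u - Im (fst u) * Im (fst u)"
    "Re (fst v) * Re (fst v) = snd v * snd v - Im (fst v) * Im (fst v)"
    "Re (fst u) * Re (fst v) = snd u * snd v - Im (fst u) * Im (fst v)"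
    using assms by (simp_all add: lorentz_def)
  show ?thesis
    by (simp add: complex_eq_iff power2_eq_square algebra_simps r)
qed

text \<open>The squared moduli differ by a multiple of \<open>Im (fst v * cnj (fst u))\<close>,
  which collinearity makes zero.\<close>

lemma null_orthogonal_norm:
  assumes "lorentz u u = 0" "lorentz v v = 0" "lorentz u v = 0"
  shows "cmod (fst v - \<i> * fst u) = cmod (cnj (fst v) - \<i> * cnj (fst u))"
proof -
  have "Im (fst u * cnj (fst v)) = Im (fst v * cnj (fst u))"
    using null_orthogonal_collinear[OF assms] by simp
  then show ?thesis
    by (simp add: cmod_def power2_eq_square algebra_simps)
qed

lemma lorentz_null_zero: "lorentz u u = 0 \<Longrightarrow> fst u = 0 \<Longrightarrow> u = 0"
  by (simp add: lorentz_def prod_eq_iff)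

text \<open>The modulus has a local maximum at \<open>z\<close>, so the maximum modulus principle
  makes \<open>f\<close> constant on the connected set \<open>S\<close>.\<close>

lemma constant_on_if_norm_1:
  assumes "f holomorphic_on S" "open S" "connected S" "z \<in> S" "open V" "z \<in> V"
    and "\<And>w. w \<in> V \<Longrightarrow> w \<in> S \<Longrightarrow> cmod (f w) = 1"
  shows "\<forall>w\<in>S. cmod (f w) = 1"
proof -
  have "f constant_on S"
    using assms by (intro maximum_modulus_principle[of f S "V \<inter> S" z]) auto
  then show ?thesis using assms(4,6,7) unfolding constant_on_def by metis
qed

lemma reflect_eq_self:
  assumes "R > 1" "f holomorphic_on sym_annulus R" "\<And>z. cmod z = 1 \<Longrightarrow> f z \<in> \<real>" "z \<in> sym_annulus R"
  shows "reflect f z = f z"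
proof (rule holomorphic_eq_if_eq_on_circle[of "sym_annulus R" 1 "reflect f" f z])
  show "reflect f holomorphic_on sym_annulus R" by (rule reflect_holomorphic[OF assms(1,2)])
qed (use assms circle_in_sym_annulus[OF assms(1)] in \<open>auto simp: reflect_unit Reals_cnj_iff\<close>)

lemma deriv_reflect_unit:
  assumes "R > 1" "f holomorphic_on sym_annulus R" "cmod z = 1"
  shows "deriv (reflect f) z = - cnj (deriv f z) / z\<^sup>2"
proof -
  have "(f has_field_derivative deriv f z) (at (inverse (cnj z)))"
    using holomorphic_derivI[OF assms(2) open_annulus circle_in_sym_annulus[OF assms(1,3)]]
    by (simp add: inverse_cnj_unit[OF assms(3)])
  moreover have "z \<noteq> 0" using assms(3) by auto
  ultimately show ?thesis
    by (intro DERIV_imp_deriv reflect_has_field_derivative)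
qed

lemma bjorling_solution_exists:
  assumes \<gamma>: "circle_analytic \<gamma>" and L: "circle_analytic L"
    and null\<gamma>: "\<And>\<theta>. lorentz (circle_deriv \<gamma> \<theta>) (circle_deriv \<gamma> \<theta>) = 0"
    and nullL: "\<And>\<theta>. lorentz (L (cis \<theta>)) (L (cis \<theta>)) = 0"
    and orth: "\<And>\<theta>. lorentz (circle_deriv \<gamma> \<theta>) (L (cis \<theta>)) = 0"
    and nz: "\<not> (\<forall>\<theta>. circle_deriv \<gamma> \<theta> = 0) \<or> \<not> (\<forall>\<theta>. L (cis \<theta>) = 0)"
    and g: "associated_g \<gamma> L g" and G: "analytic_extension g U G"
    and nonunit: "\<not> (\<forall>z\<in>U. cmod (G z) = 1)"
  shows "\<exists>r R F. bjorling_solution \<gamma> L r R F"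
proof -
  obtain R1 c1 c3 where c: "R1 > 1" "c1 holomorphic_on sym_annulus R1" "c3 holomorphic_on sym_annulus R1"
    "\<And>z. cmod z = 1 \<Longrightarrow> c1 z = fst (\<gamma> z)" "\<And>z. cmod z = 1 \<Longrightarrow> c3 z = of_real (snd (\<gamma> z))"
    using circle_analytic_pair_extension[OF \<gamma>] by metis
  obtain R2 l1 l3 where l: "R2 > 1" "l1 holomorphic_on sym_annulus R2" "l3 holomorphic_on sym_annulus R2"
    "\<And>z. cmod z = 1 \<Longrightarrow> l1 z = fst (L z)" "\<And>z. cmod z = 1 \<Longrightarrow> l3 z = of_real (snd (L z))"
    using circle_analytic_pair_extension[OF L] by metis
  define R where "R = min R1 R2"
  have R: "R > 1" using c(1) l(1) by (simp add: R_def)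
  have "sym_annulus R \<subseteq> sym_annulus R1" "sym_annulus R \<subseteq> sym_annulus R2"
    using c(1) l(1) by (simp_all add: sym_annulus_mono R_def)
  then have hol: "c1 holomorphic_on sym_annulus R" "c3 holomorphic_on sym_annulus R"
    "l1 holomorphic_on sym_annulus R" "l3 holomorphic_on sym_annulus R"
    using c(2,3) l(2,3) by (auto intro: holomorphic_on_subset)
  have circ: "sphere 0 1 \<subseteq> sym_annulus R" using circle_in_sym_annulus[OF R] by auto
  \<comment> \<open>These are the coefficients that the harmonic Cauchy problem yields for the data
    \<open>c1\<close>, \<open>l1\<close> (giving \<open>p\<close>, \<open>q\<close>) and
    \<open>c3\<close>, \<open>l3\<close> (giving \<open>m\<close>).\<close>
  define p where "p z = (l1 z / z + deriv c1 z) / 2" for z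
  define q where "q z = (reflect l1 z / z + deriv (reflect c1) z) / 2" for z
  define m where "m z = (l3 z / z + deriv c3 z) / 2" for z
  have holp: "p holomorphic_on sym_annulus R" and holq: "q holomorphic_on sym_annulus R"
    and holm: "m holomorphic_on sym_annulus R"
    unfolding p_def q_def m_def using sym_annulus_nonzero[OF R]
    by (auto intro!: holomorphic_intros hol reflect_holomorphic R)
  note d\<gamma> = circle_deriv_extension[OF open_annulus circ hol(1,2) c(4,5)]
  have p_cis: "p (cis \<theta>) = (fst (L (cis \<theta>)) - \<i> * fst (circle_deriv \<gamma> \<theta>)) / (2 * cis \<theta>)"
    and q_cis: "q (cis \<theta>) = (cnj (fst (L (cis \<theta>))) - \<i> * cnj (fst (circle_deriv \<gamma> \<theta>))) / (2 * cis \<theta>)"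
    and m_cis: "m (cis \<theta>) = (of_real (snd (L (cis \<theta>))) - \<i> * of_real (snd (circle_deriv \<gamma> \<theta>))) / (2 * cis \<theta>)"
    for \<theta>
  proof -
    let ?z = "cis \<theta>"
    show "p ?z = (fst (L ?z) - \<i> * fst (circle_deriv \<gamma> \<theta>)) / (2 * ?z)"
      by (simp add: p_def l(4) d\<gamma>(1)[symmetric] field_simps)
    show "m ?z = (of_real (snd (L ?z)) - \<i> * of_real (snd (circle_deriv \<gamma> \<theta>))) / (2 * ?z)"
      by (simp add: m_def l(5) d\<gamma>(2)[symmetric] field_simps)
    have "cnj ?z * ?z = 1" by (simp add: cis_cnj cis_mult)
    \<comment> \<open>This absorbs the factor \<open>1 / z^2\<close> from the derivative of the
      reflection.\<close>
    then have "?z\<^sup>2 * cnj ?z = ?z" by (simp add: power2_eq_square mult.assoc mult.commute)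
    then show "q ?z = (cnj (fst (L ?z)) - \<i> * cnj (fst (circle_deriv \<gamma> \<theta>))) / (2 * ?z)"
      by (simp add: q_def l(4) reflect_unit deriv_reflect_unit[OF R hol(1)] d\<gamma>(1)[symmetric] field_simps)
  qed
  note pqm = p_cis q_cis m_cis
  have conf: "p z * q z = (m z)\<^sup>2" if "z \<in> sym_annulus R" for z
  proof (rule holomorphic_eq_if_eq_on_circle[of "sym_annulus R" 1 "\<lambda>z. p z * q z" "\<lambda>z. (m z)\<^sup>2" z])
    fix w assume "cmod w = 1"
    then obtain t where t: "w = cis t" using unit_circle_cis by blast
    show "p w * q w = (m w)\<^sup>2"
      using null_orthogonal_conformal[OF null\<gamma> nullL orth, of t]
      by (simp add: t pqm power_divide power2_eq_square)
  qed (use that circle_in_sym_annulus[OF R] in \<open>auto intro!: holomorphic_intros holp holq holm\<close>)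
  have sing: "cmod (p z) = cmod (q z)" if z: "cmod z = 1" for z
  proof -
    obtain t where "z = cis t" using unit_circle_cis[OF z] by blast
    then show ?thesis
      using null_orthogonal_norm[OF null\<gamma> nullL orth, of t] by (simp add: pqm norm_divide)
  qed
  have nondeg: "\<not> (\<forall>z\<in>sym_annulus R. cmod (p z) = cmod (q z))"
  proof
    assume eq: "\<forall>z\<in>sym_annulus R. cmod (p z) = cmod (q z)"
    have U: "open U" "connected U" "sphere 0 1 \<subseteq> U" "G holomorphic_on U" "\<And>\<theta>. G (cis \<theta>) = g (cis \<theta>)"
      using G by (auto simp: analytic_extension_def)
    have "1 \<in> U \<inter> sym_annulus R" using U(3) circ by auto
    \<comment> \<open>The intersection of \<open>U\<close> with the annulus need not be connected,
      so the comparison with \<open>G\<close> is made on a ball around 1.\<close>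
    then obtain e where e: "e > 0" "ball 1 e \<subseteq> U \<inter> sym_annulus R"
      using U(1) open_contains_ball_eq[of "U \<inter> sym_annulus R"] by (meson open_Int open_annulus)
    have pG: "p z = (G z)\<^sup>2 * q z" if "z \<in> ball 1 e" for z
    proof (rule holomorphic_eq_if_eq_on_circle[of "ball 1 e" 1 p "\<lambda>z. (G z)\<^sup>2 * q z" z])
      show "p holomorphic_on ball 1 e" "(\<lambda>z. (G z)\<^sup>2 * q z) holomorphic_on ball 1 e"
        using e(2) by (auto intro!: holomorphic_intros intro: holomorphic_on_subset[OF holp]
            holomorphic_on_subset[OF holq] holomorphic_on_subset[OF U(4)])
      fix w assume "cmod w = 1"
      then obtain t where t: "w = cis t" using unit_circle_cis by blast
      \<comment> \<open>Clearing the denominator extends the defining relation of \<open>g\<close>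
        to the zeros of the vector.\<close>
      have quot: "fst u = x * cnj (fst u)" if "cnj (fst u) \<noteq> 0 \<longrightarrow> x = dir_quotient u" for u x
        using that by (cases "fst u = 0") (simp_all add: dir_quotient_def)
      have "fst (circle_deriv \<gamma> t) = (G w)\<^sup>2 * cnj (fst (circle_deriv \<gamma> t))"
        using g unfolding associated_g_def t U(5) by (intro quot) blast
      moreover have "fst (L w) = (G w)\<^sup>2 * cnj (fst (L w))"
        using g unfolding associated_g_def t U(5) by (intro quot) blast
      ultimately have "fst (L w) - \<i> * fst (circle_deriv \<gamma> t) =
          (G w)\<^sup>2 * (cnj (fst (L w)) - \<i> * cnj (fst (circle_deriv \<gamma> t)))"
        by (metis right_diff_distrib mult.left_commute)
      then show "p w = (G w)\<^sup>2 * q w" by (simp add: t pqm)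
    qed (use e that in auto)
    \<comment> \<open>If \<open>q\<close> vanished on the ball, then \<open>q\<close>, and with it
      \<open>p\<close>, would vanish on the annulus, forcing both \<open>\<gamma>'\<close> and
      \<open>L\<close> to be zero along the circle.\<close>
    have "\<exists>z\<in>ball 1 e. q z \<noteq> 0"
    proof (rule ccontr)
      assume *: "\<not> (\<exists>z\<in>ball 1 e. q z \<noteq> 0)"
      have q0: "q z = 0" if "z \<in> sym_annulus R" for z
        using analytic_continuation_open[of "ball 1 e" "sym_annulus R" q "\<lambda>_. 0" z] * e that holq by auto
      then have p0: "p z = 0" if "z \<in> sym_annulus R" for z using eq that by auto
      have "fst (L (cis t)) = 0 \<and> fst (circle_deriv \<gamma> t) = 0" for t
      proof -
        have "cis t \<in> sym_annulus R" by (simp add: circle_in_sym_annulus R)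
        then have "p (cis t) = 0" "q (cis t) = 0" using p0 q0 by simp_all
        then have 1: "fst (L (cis t)) = \<i> * fst (circle_deriv \<gamma> t)"
          and "cnj (fst (L (cis t))) = \<i> * cnj (fst (circle_deriv \<gamma> t))"
          by (auto simp: pqm)
        \<comment> \<open>Conjugation turns i into -i, so the two equations force the planar part to
          vanish.\<close>
        then have "cnj (\<i> * fst (circle_deriv \<gamma> t)) = \<i> * cnj (fst (circle_deriv \<gamma> t))" by simp
        then have "fst (circle_deriv \<gamma> t) = 0" by simp
        then show ?thesis using 1 by simp
      qed
      then show False using nz lorentz_null_zero null\<gamma> nullL by metis
    qed
    then obtain z1 where z1: "z1 \<in> ball 1 e" "q z1 \<noteq> 0" by blast
    \<comment> \<open>Where \<open>q\<close> is nonzero, \<open>p = G^2 q\<close> and equality of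
      the moduli give \<open>|G| = 1\<close>; this then spreads over the connected set
      \<open>U\<close>.\<close>
    define V where "V = {z \<in> ball 1 e. q z \<noteq> 0}"
    have "open V"
    proof -
      have "continuous_on (ball 1 e) q"
        using e(2) holomorphic_on_imp_continuous_on[OF holq] by (auto intro: continuous_on_subset)
      from continuous_open_preimage[OF this open_ball, of "- {0}"] show ?thesis
        by (simp add: V_def vimage_def Int_def open_Compl)
    qed
    moreover have "cmod (G z) = 1" if "z \<in> V" for z
    proof -
      have z: "z \<in> ball 1 e" "q z \<noteq> 0" "z \<in> sym_annulus R" using that e(2) by (auto simp: V_def)
      have "cmod (p z) = (cmod (G z))\<^sup>2 * cmod (q z)"
        using pG[OF z(1)] by (simp add: norm_mult norm_power)
      then have "(cmod (G z))\<^sup>2 = 1" using eq z by simp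
      then show ?thesis using norm_ge_zero[of "G z"] by (auto simp: power2_eq_1_iff simp del: norm_ge_zero)
    qed
    ultimately have "\<forall>z\<in>U. cmod (G z) = 1"
      using z1 e(2) by (intro constant_on_if_norm_1[OF U(4,1,2), of z1 V]) (auto simp: V_def)
    then show False using nonunit by blast
  qed
  obtain h where h: "\<And>z. z \<in> sym_annulus R \<Longrightarrow> (h has_derivative (\<lambda>v. p z * v + cnj (q z * v))) (at z)"
    "\<And>z. cmod z = 1 \<Longrightarrow> h z = c1 z"
    using harmonic_on_sym_annulus_with_cauchy_data[OF R hol(1,3)] unfolding p_def q_def by metis
  obtain k where k: "\<And>z. z \<in> sym_annulus R \<Longrightarrow> (k has_derivative
      (\<lambda>v. m z * v + cnj ((reflect l3 z / z + deriv (reflect c3) z) / 2 * v))) (at z)"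
    "\<And>z. cmod z = 1 \<Longrightarrow> k z = c3 z"
    using harmonic_on_sym_annulus_with_cauchy_data[OF R hol(2,4)] unfolding m_def by metis
  \<comment> \<open>The third components are real on the circle, so reflection fixes their
    extensions and the two coefficients of \<open>k\<close> coincide.\<close>
  have reflect3: "(reflect l3 z / z + deriv (reflect c3) z) / 2 = m z" if z: "z \<in> sym_annulus R" for z
  proof -
    have "reflect l3 z = l3 z" by (rule reflect_eq_self[OF R hol(4) _ z]) (simp add: l(5))
    moreover have "deriv (reflect c3) z = deriv c3 z"
      by (rule complex_derivative_transform_within_open[OF reflect_holomorphic[OF R hol(2)] hol(2) open_annulus z])
        (simp add: reflect_eq_self[OF R hol(2)] c(5))
    ultimately show ?thesis by (simp add: m_def)
  qed
  define F where "F z = (h z, Re (k z))" for z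
  have F: "(F has_derivative (\<lambda>v. (p z * v + cnj (q z * v), 2 * Re (m z * v)))) (at z)"
    if z: "z \<in> sym_annulus R" for z
  proof -
    have "(F has_derivative (\<lambda>v. (p z * v + cnj (q z * v), Re (m z * v + cnj (m z * v))))) (at z)"
      unfolding F_def
      using k(1)[OF z, unfolded reflect3[OF z]]
      by (intro has_derivative_Pair h(1)[OF z] bounded_linear.has_derivative[OF bounded_linear_Re])
    then show ?thesis by (simp only: complex_add_cnj Re_complex_of_real)
  qed
  note surf = generalised_maximal_surfaceI[OF open_annulus connected_annulus_complex holp holq holm F conf nondeg]
  have "bjorling_solution \<gamma> L (1 / R) R F"
    unfolding bjorling_solution_def
  proof (intro conjI allI)
    show "0 < 1 / R" "1 / R < 1" "1 < R" using R by auto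
    show "generalised_maximal_surface (sym_annulus R) F" by (rule surf(1))
    show "F (cis \<theta>) = \<gamma> (cis \<theta>)" for \<theta>
      by (simp add: F_def h(2) k(2) c(4,5))
    show "((\<lambda>\<rho>. F (complex_of_real \<rho> * cis \<theta>)) has_vector_derivative L (cis \<theta>)) (at 1)" for \<theta>
    proof -
      have div2: "x / (2 * cis \<theta>) * cis \<theta> = x / 2" for x by simp
      \<comment> \<open>The radial derivative is the differential applied to
        \<open>cis \<theta>\<close>; in it the contributions of \<open>\<gamma>'\<close> cancel and
        the two halves of \<open>L\<close> add up.\<close>
      have "(p (cis \<theta>) * cis \<theta> + cnj (q (cis \<theta>) * cis \<theta>), 2 * Re (m (cis \<theta>) * cis \<theta>)) = L (cis \<theta>)"
        unfolding pqm div2 by (auto simp: prod_eq_iff complex_eq_iff field_simps)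
      then show ?thesis
        using radial_has_vector_derivative[OF F, of \<theta>] by (simp only: circle_in_sym_annulus[OF R] norm_cis)
    qed
    show "sphere 0 1 \<subseteq> singular_set (sym_annulus R) F"
      using circ surf(2,3) sing by (auto simp: singular_set_def)
  qed
  then show ?thesis by blast
qed

text \<open>The radii may vary between solutions, so uniqueness means agreement on the common
  annulus.\<close>

theorem theorem3p1:
  fixes \<gamma> L :: "complex \<Rightarrow> complex \<times> real"
    and g G :: "complex \<Rightarrow> complex"
    and U :: "complex set"
  assumes "circle_analytic \<gamma>"
    and "circle_analytic L"
    and "\<And>\<theta>. lorentz (circle_deriv \<gamma> \<theta>) (circle_deriv \<gamma> \<theta>) = 0"
    and "\<And>\<theta>. lorentz (L (cis \<theta>)) (L (cis \<theta>)) = 0"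
    and "\<And>\<theta>. lorentz (circle_deriv \<gamma> \<theta>) (L (cis \<theta>)) = 0"
    and "\<not> (\<forall>\<theta>. circle_deriv \<gamma> \<theta> = 0) \<or> \<not> (\<forall>\<theta>. L (cis \<theta>) = 0)"
    and "associated_g \<gamma> L g"
    and "analytic_extension g U G"
    and "\<not> (\<forall>z\<in>U. cmod (G z) = 1)"
  shows "(\<exists>r R F. bjorling_solution \<gamma> L r R F) \<and>
         (\<forall>r R F r' R' F'. bjorling_solution \<gamma> L r R F \<longrightarrow> bjorling_solution \<gamma> L r' R' F' \<longrightarrow>
            (\<forall>z \<in> annulus r R \<inter> annulus r' R'. F z = F' z))"
  using bjorling_solution_exists[OF assms] bjorling_solution_unique by blast

end
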